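(* Let $G$ be a simple graph with $n$ vertices, $m$ edges and maximum density $d^*$. For every fixed $\epsilon>0$, a partition of the edge set of $G$ into $k\le\lceil(1+\epsilon)d^*\rceil$ pseudoforests can be computed in time $O(m\log n)$.
   Context: A pseudoforest is a graph in which each connected component contains at most one cycle. The maximum density is $d^*(G)=\max_{(V_H,E_H)\subseteq G}|E_H|/|V_H|$. Graphs satisfy $n\ge2$, $m\ge n$. *)

theory Defs
  imports Complex_Main "HOL-Library.Disjoint_Sets"
begin

definition simple_graph :: "'a set \<Rightarrow> 'a set set \<Rightarrow> bool" where
  "simple_graph V E \<longleftrightarrow> finite V \<and> (\<forall>e\<in>E. e \<subseteq> V \<and> card e = 2)"

definition subgraph :: "'a set \<Rightarrow> 'a set set \<Rightarrow> 'a set \<Rightarrow> 'a set set \<Rightarrow> bool" where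
  "subgraph V' E' V E \<longleftrightarrow> V' \<subseteq> V \<and> E' \<subseteq> E \<and> simple_graph V' E'"

definition max_density :: "'a set \<Rightarrow> 'a set set \<Rightarrow> real" where
  "max_density V E =
     Max {real (card E') / real (card V') | V' E'. V' \<noteq> {} \<and> subgraph V' E' V E}"

definition adjacency :: "'a set set \<Rightarrow> ('a \<times> 'a) set" where
  "adjacency E = {(u, v). {u, v} \<in> E}"

definition components :: "'a set \<Rightarrow> 'a set set \<Rightarrow> 'a set set" where
  "components V E = V // {(u, v) \<in> V \<times> V. (u, v) \<in> (adjacency E)\<^sup>*}"

definition cycle_edges :: "'a list \<Rightarrow> 'a set set" where
  "cycle_edges xs = {{xs ! i, xs ! (Suc i mod length xs)} | i. i < length xs}"

text \<open>
  A cycle is identified with its edge set, so that different starting points and directions of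
  traversal do not give different cycles.
\<close>

definition cycle_in :: "'a set set \<Rightarrow> 'a set set \<Rightarrow> bool" where
  "cycle_in E C \<longleftrightarrow>
     C \<subseteq> E \<and> (\<exists>xs. distinct xs \<and> 3 \<le> length xs \<and> C = cycle_edges xs)"

definition pseudoforest :: "'a set \<Rightarrow> 'a set set \<Rightarrow> bool" where
  "pseudoforest V E \<longleftrightarrow> simple_graph V E \<and>
     (\<forall>K\<in>components V E. \<exists>\<^sub>\<le>\<^sub>1 C. cycle_in {e \<in> E. e \<subseteq> K} C)"

definition pseudoforest_partition :: "'a set \<Rightarrow> 'a set set \<Rightarrow> 'a set set set \<Rightarrow> bool" where
  "pseudoforest_partition V E \<F> \<longleftrightarrow>
     partition_on E \<F> \<and> (\<forall>F\<in>\<F>. pseudoforest V F)"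

text \<open>
  A unit-cost word RAM. Programs are finite terms of a while language over registers and arrays of machine words.
  Array names are static, so a given program uses a fixed number of arrays; interleaving them in
  one linear memory costs only a constant factor. The sole indirect access is by array index.

  The parameter \<open>w\<close> of the semantics is the word length in bits. An instruction whose result does
  not fit into \<open>w\<close> bits has no transition (there is no wrap-around), so an execution only exists
  if all computed values, and hence all addresses, fit into machine words. Subtraction is truncated
  at zero and division is integer division. Every instruction and every test costs one time unit.
\<close>

datatype operand = Imm nat | Reg nat

datatype arith = Add | Sub | Mul | Div

datatype comparison = Lt | Le | Eq | Neq

datatype com =
    Skip
  | Move nat operand
  | Arith nat arith operand operand
  | Load nat nat operand
  | Store nat operand operand
  | Seq com com
  | If comparison operand operand com com
  | While comparison operand operand com

record state =
  reg :: "nat \<Rightarrow> nat"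
  arr :: "nat \<Rightarrow> nat \<Rightarrow> nat"

fun operand_val :: "operand \<Rightarrow> state \<Rightarrow> nat" where
  "operand_val (Imm k) s = k"
| "operand_val (Reg r) s = reg s r"

fun arith_val :: "arith \<Rightarrow> nat \<Rightarrow> nat \<Rightarrow> nat" where
  "arith_val Add x y = x + y"
| "arith_val Sub x y = x - y"
| "arith_val Mul x y = x * y"
| "arith_val Div x y = x div y"

fun comparison_val :: "comparison \<Rightarrow> nat \<Rightarrow> nat \<Rightarrow> bool" where
  "comparison_val Lt x y \<longleftrightarrow> x < y"
| "comparison_val Le x y \<longleftrightarrow> x \<le> y"
| "comparison_val Eq x y \<longleftrightarrow> x = y"
| "comparison_val Neq x y \<longleftrightarrow> x \<noteq> y"

definition set_reg :: "nat \<Rightarrow> nat \<Rightarrow> state \<Rightarrow> state" where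
  "set_reg r x s = s\<lparr>reg := (reg s)(r := x)\<rparr>"

definition set_arr :: "nat \<Rightarrow> nat \<Rightarrow> nat \<Rightarrow> state \<Rightarrow> state" where
  "set_arr a i x s = s\<lparr>arr := (arr s)(a := (arr s a)(i := x))\<rparr>"

text \<open>\<open>exec w c s t s'\<close>: started in \<open>s\<close>, program \<open>c\<close> halts in \<open>s'\<close> after \<open>t\<close> time units.\<close>

inductive exec :: "nat \<Rightarrow> com \<Rightarrow> state \<Rightarrow> nat \<Rightarrow> state \<Rightarrow> bool" for w :: nat where
  Skip: "exec w Skip s 1 s"
| Move: "x = operand_val p s \<Longrightarrow> x < 2 ^ w \<Longrightarrow> exec w (Move r p) s 1 (set_reg r x s)"
| Arith: "x = arith_val f (operand_val p s) (operand_val q s) \<Longrightarrow> x < 2 ^ w \<Longrightarrow>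
    exec w (Arith r f p q) s 1 (set_reg r x s)"
| Load: "i = operand_val p s \<Longrightarrow> i < 2 ^ w \<Longrightarrow>
    exec w (Load r a p) s 1 (set_reg r (arr s a i) s)"
| Store: "i = operand_val p s \<Longrightarrow> i < 2 ^ w \<Longrightarrow> x = operand_val q s \<Longrightarrow> x < 2 ^ w \<Longrightarrow>
    exec w (Store a p q) s 1 (set_arr a i x s)"
| Seq: "exec w c1 s t1 s' \<Longrightarrow> exec w c2 s' t2 s'' \<Longrightarrow> exec w (Seq c1 c2) s (t1 + t2) s''"
| IfTrue: "comparison_val b (operand_val p s) (operand_val q s) \<Longrightarrow> exec w c1 s t s' \<Longrightarrow>
    exec w (If b p q c1 c2) s (1 + t) s'"
| IfFalse: "\<not> comparison_val b (operand_val p s) (operand_val q s) \<Longrightarrow> exec w c2 s t s' \<Longrightarrow>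
    exec w (If b p q c1 c2) s (1 + t) s'"
| WhileFalse: "\<not> comparison_val b (operand_val p s) (operand_val q s) \<Longrightarrow>
    exec w (While b p q c) s 1 s"
| WhileTrue: "comparison_val b (operand_val p s) (operand_val q s) \<Longrightarrow> exec w c s t1 s' \<Longrightarrow>
    exec w (While b p q c) s' t2 s'' \<Longrightarrow> exec w (While b p q c) s (1 + t1 + t2) s''"

lemma exec_deterministic:
  "exec w c s t s' \<Longrightarrow> exec w c s u s'' \<Longrightarrow> t = u \<and> s' = s''"
proof (induction arbitrary: u s'' rule: exec.induct)
  case Seq
  from Seq.prems show ?case by cases (use Seq.IH in blast)
next
  case IfTrue
  from IfTrue.prems show ?case by cases (use IfTrue.IH IfTrue.hyps in blast)+
next
  case IfFalse
  from IfFalse.prems show ?case by cases (use IfFalse.IH IfFalse.hyps in blast)+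
next
  case WhileFalse
  from WhileFalse.prems show ?case by cases (use WhileFalse.hyps in blast)+
next
  case WhileTrue
  from WhileTrue.prems show ?case by cases (use WhileTrue.IH WhileTrue.hyps in blast)+
qed (erule exec.cases; simp)+

text \<open>
  The vertices of an input graph are \<open>0, \<dots>, n - 1\<close>. Its edges are given as a list of pairs, in any
  order and each edge in either orientation, but listed only once.
\<close>

definition ends :: "'a \<times> 'a \<Rightarrow> 'a set" where
  "ends e = {fst e, snd e}"

definition lists_edges :: "('a \<times> 'a) list \<Rightarrow> 'a set set \<Rightarrow> bool" where
  "lists_edges es E \<longleftrightarrow> distinct (map ends es) \<and> set (map ends es) = E"

text \<open>
  Registers 0 and 1 hold the numbers of vertices and edges, arrays 0 and 1 the two endpoints of the
  listed edges; everything else is initially zero.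
\<close>

definition input_state :: "nat \<Rightarrow> (nat \<times> nat) list \<Rightarrow> state" where
  "input_state n es = \<lparr>
     reg = (\<lambda>r. if r = 0 then n else if r = 1 then length es else 0),
     arr = (\<lambda>a i. if a = 0 \<and> i < length es then fst (es ! i)
                  else if a = 1 \<and> i < length es then snd (es ! i) else 0)\<rparr>"

text \<open>
  A family of \<open>k\<close> edge sets is output by leaving \<open>k\<close> in register 0 and, for every listed edge, the
  number \<open>< k\<close> of its class in array 2.
\<close>

definition outputs_family :: "state \<Rightarrow> (nat \<times> nat) list \<Rightarrow> nat set set set \<Rightarrow> bool" where
  "outputs_family s es \<F> \<longleftrightarrow>
     card \<F> = reg s 0 \<and>
     (\<forall>j<length es. arr s 2 j < reg s 0) \<and>
     \<F> = {{ends (es ! j) | j. j < length es \<and> arr s 2 j = l} | l. l < reg s 0}"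

end

theory Submission
  imports Defs "HOL-Library.Log_Nat"
begin

text \<open>
  An orientation with maximum out-degree \<open>k\<close> yields a partition into \<open>k\<close> pseudoforests: number the
  out-edges of every vertex, and observe that an edge set with out-degree at most one has at most
  one cycle per component, since all edges of a component lead into that cycle.

  To find an orientation for a given \<open>k\<close>, excess out-degree is pushed along edges by the
  push-relabel method, with labels that may drop by at most one along every edge. Every vertex with
  a positive label has out-degree at least \<open>k\<close>, so the sets \<open>S\<^sub>i\<close> of vertices with label at least
  \<open>i\<close> satisfy \<open>k \<cdot> |S\<^sub>i\<^sub>+\<^sub>1| \<le> d\<^sup>* \<cdot> |S\<^sub>i|\<close>. If \<open>k \<ge> (1 + 1/b) d\<^sup>*\<close>, then these sets shrink geometrically and
  the labels stay below a cap of \<open>O(b log n)\<close>. As all capacities are one, a test of \<open>k\<close> takes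
  \<open>O(m)\<close> steps per label value.

  Only constantly many values of \<open>k\<close> have to be tested. Let \<open>\<rho>\<close> be the largest density, rounded
  down, seen so far while vertices of degree less than \<open>4 \<rho> + 4\<close> are removed in rounds. Every round
  removes more than half of the vertices, and in the end \<open>\<rho> \<le> d\<^sup>* \<le> 8 \<rho>\<close>. Then \<open>k\<close> runs from \<open>\<rho>\<close>
  upwards in steps of \<open>\<lfloor>\<rho> / b\<rfloor> + 1\<close>, and the first success satisfies \<open>k - 1 < (1 + 2/b) d\<^sup>*\<close>.
\<close>

section \<open>Edge sets with out-degree at most one\<close>

text \<open>The two edges lead to the cyclic successor and predecessor of \<open>v\<close>; length
  at least 3 makes these neighbours different.\<close>

lemma cycle_edges_incident:
  assumes "distinct xs" "3 \<le> length xs" "v \<in> set xs"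
  obtains e e' where "e \<in> cycle_edges xs" "e' \<in> cycle_edges xs" "v \<in> e" "v \<in> e'" "e \<noteq> e'"
proof -
  define p where "p = length xs"
  obtain i where i: "i < p" "v = xs ! i"
    using assms(3) by (auto simp: in_set_conv_nth p_def)
  define h where "h = (if i = 0 then p - 1 else i - 1)"
  have h: "h < p" "Suc h mod p = i" using i assms(2) by (auto simp: h_def p_def)
  define g where "g = Suc i mod p"
  have g: "g < p" unfolding g_def using i by (intro mod_less_divisor) linarith
  have ne: "g \<noteq> i" "h \<noteq> i" "g \<noteq> h"
    using i assms(2) by (auto simp: g_def h_def p_def mod_Suc split: if_splits)
  have nx: "xs ! g \<noteq> xs ! i" "xs ! h \<noteq> xs ! i" "xs ! g \<noteq> xs ! h"
    using ne g h i assms(1) by (auto simp: p_def nth_eq_iff_index_eq)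
  have "{xs ! i, xs ! g} \<in> cycle_edges xs"
    unfolding cycle_edges_def g_def p_def using i p_def by blast
  moreover have "{xs ! h, xs ! i} \<in> cycle_edges xs"
    unfolding cycle_edges_def using h p_def by force
  moreover have "{xs ! i, xs ! g} \<noteq> {xs ! h, xs ! i}" using nx by (auto simp: doubleton_eq_iff)
  ultimately show ?thesis using that i by blast
qed

text \<open>Every position is reached from position \<open>i\<close> by repeated cyclic
  shifts.\<close>

lemma cycle_edges_connected:
  assumes cl: "\<And>i. i < length xs \<Longrightarrow> xs ! i \<in> X \<Longrightarrow> xs ! (Suc i mod length xs) \<in> X"
    and "i < length xs" "xs ! i \<in> X"
  shows "set xs \<subseteq> X"
proof -
  have *: "xs ! ((i + d) mod length xs) \<in> X" for d
  proof (induction d)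
    case 0 then show ?case using assms by simp
  next
    case (Suc d)
    have "Suc (i + d) mod length xs = Suc ((i + d) mod length xs) mod length xs"
      by (simp add: mod_Suc_eq)
    moreover have "(i + d) mod length xs < length xs" using assms(2) by (intro mod_less_divisor) auto
    ultimately show ?case using cl[OF _ Suc.IH] by simp
  qed
  show ?thesis
  proof
    fix x assume "x \<in> set xs"
    then obtain j where j: "j < length xs" "x = xs ! j" by (auto simp: in_set_conv_nth)
    \<comment> \<open>A shift by \<open>length xs - i + j\<close> instead of \<open>j - i\<close>
      avoids truncated subtraction when \<open>j < i\<close>.\<close>
    have "(i + (length xs - i + j)) mod length xs = j"
      using assms(2) j by simp
    then show "x \<in> X" using *[of "length xs - i + j"] j by simp
  qed
qed

lemma Union_cycle_edges: "3 \<le> length xs \<Longrightarrow> \<Union> (cycle_edges xs) = set xs"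
proof
  assume l: "3 \<le> length xs"
  then have "0 < length xs" by linarith
  then show "\<Union> (cycle_edges xs) \<subseteq> set xs"
    unfolding cycle_edges_def by (force intro!: nth_mem mod_less_divisor)
  show "set xs \<subseteq> \<Union> (cycle_edges xs)"
  proof
    fix x assume "x \<in> set xs"
    then obtain i where "i < length xs" "x = xs ! i" by (auto simp: in_set_conv_nth)
    then show "x \<in> \<Union> (cycle_edges xs)" unfolding cycle_edges_def by blast
  qed
qed

text \<open>Every edge is directed away from its \<open>tail\<close>. Injectivity of
  \<open>tail\<close> says that no vertex has two out-edges, which makes the relation
  \<open>succ\<close> below a partial function.\<close>

locale out_degree_one =
  fixes F :: "'a set set" and tail :: "'a set \<Rightarrow> 'a"
  assumes tail_in: "e \<in> F \<Longrightarrow> tail e \<in> e"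
    and tail_inj: "inj_on tail F"
    and edge_card: "e \<in> F \<Longrightarrow> card e = 2"
begin

definition succ :: "('a \<times> 'a) set" where
  "succ = {(u, v). u \<noteq> v \<and> {u, v} \<in> F \<and> tail {u, v} = u}"

lemma succ_unique: "(u, v) \<in> succ \<Longrightarrow> (u, v') \<in> succ \<Longrightarrow> v = v'"
proof -
  assume "(u, v) \<in> succ" "(u, v') \<in> succ"
  then have "{u, v} = {u, v'}" using inj_onD[OF tail_inj, of "{u, v}" "{u, v'}"] by (auto simp: succ_def)
  then show ?thesis by (auto simp: doubleton_eq_iff)
qed

lemma edge_succ: "{u, v} \<in> F \<Longrightarrow> (u, v) \<in> succ \<or> (v, u) \<in> succ"
proof -
  assume e: "{u, v} \<in> F"
  then have "u \<noteq> v" using edge_card[of "{u, v}"] by auto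
  moreover have "tail {u, v} = u \<or> tail {u, v} = v" using tail_in[OF e] by simp
  ultimately show ?thesis using e unfolding succ_def by (auto simp: insert_commute[of v u])
qed

definition cyc_succ :: "'a set set \<Rightarrow> 'a \<Rightarrow> 'a" where
  "cyc_succ C u = (SOME v. (u, v) \<in> succ \<and> {u, v} \<in> C)"

context
  fixes C xs
  assumes cyc: "C \<subseteq> F" "distinct xs" "3 \<le> length xs" "C = cycle_edges xs"
begin

text \<open>Two cycle edges meet at \<open>v\<close>, and by injectivity at most one of them has
  tail \<open>v\<close>; the other one is directed into \<open>v\<close>.\<close>

lemma cycle_pred:
  assumes "v \<in> set xs"
  shows "\<exists>u\<in>set xs. (u, v) \<in> succ \<and> {u, v} \<in> C"
proof -
  obtain e e' where e: "e \<in> C" "e' \<in> C" "v \<in> e" "v \<in> e'" "e \<noteq> e'"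
    using cycle_edges_incident[of xs v] cyc assms by blast
  then have "tail e \<noteq> tail e'" using inj_onD[OF tail_inj] cyc by blast
  then obtain d where d: "d \<in> C" "v \<in> d" "tail d \<noteq> v" using e by metis
  have "card d = 2" "tail d \<in> d" using d cyc edge_card tail_in by blast+
  then have "d = {tail d, v}" using d by (auto simp: card_2_iff)
  moreover have "tail d \<in> set xs" using d \<open>tail d \<in> d\<close> Union_cycle_edges cyc by blast
  ultimately show ?thesis using d cyc unfolding succ_def by (intro bexI[of _ "tail d"]) auto
qed

lemma cycle_vertices_tails: "set xs = tail ` C"
proof -
  have finC: "finite C" unfolding cyc(4) cycle_edges_def by simp
  have cC: "card C \<le> card (set xs)"
  proof -
    have "C = (\<lambda>i. {xs ! i, xs ! (Suc i mod length xs)}) ` {..<length xs}"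
      unfolding cyc(4) cycle_edges_def by auto
    then show ?thesis using cyc(2) card_image_le[of "{..<length xs}"]
      by (simp add: distinct_card)
  qed
  define P where "P v = (SOME u. (u, v) \<in> succ \<and> {u, v} \<in> C)" for v
  have P: "(P v, v) \<in> succ" "{P v, v} \<in> C" if "v \<in> set xs" for v
    using someI_ex[of "\<lambda>u. (u, v) \<in> succ \<and> {u, v} \<in> C"] cycle_pred[OF that] unfolding P_def by blast+
  have "inj_on P (set xs)"
    using P succ_unique by (metis inj_onI)
  moreover have "P ` set xs \<subseteq> tail ` C"
    using P unfolding succ_def by force
  moreover have "tail ` C \<subseteq> set xs" using tail_in cyc Union_cycle_edges by blast
  ultimately show ?thesis
    by (metis List.finite_set card_image card_seteq finC finite_imageI order_trans card_mono)
qed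

text \<open>A directed walk cannot leave a cycle: the only out-edge of a cycle vertex is the cycle
  edge of which it is the tail.\<close>

lemma cycle_succ:
  assumes "u \<in> set xs" "(u, v) \<in> succ"
  shows "{u, v} \<in> C" "v \<in> set xs"
proof -
  obtain e where e: "e \<in> C" "tail e = u"
    using assms(1) unfolding cycle_vertices_tails by blast
  have "e = {u, v}" using e assms(2) inj_onD[OF tail_inj] cyc(1) unfolding succ_def by blast
  then show "{u, v} \<in> C" using e by simp
  then show "v \<in> set xs" using Union_cycle_edges cyc by blast
qed

text \<open>The predecessor map \<open>P\<close> permutes \<open>set xs\<close> and maps the
  complement of \<open>X\<close> into itself, so it also preserves \<open>X\<close>. Thus
  \<open>X\<close> is closed along cycle edges in both directions, and going round the list never
  leaves it, however the single edges are directed.\<close>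

lemma cycle_closed_subset:
  assumes X: "X \<subseteq> set xs" "X \<noteq> {}" and cl: "\<And>u v. u \<in> X \<Longrightarrow> (u, v) \<in> succ \<Longrightarrow> v \<in> X"
  shows "X = set xs"
proof -
  define P where "P v = (SOME u. u \<in> set xs \<and> (u, v) \<in> succ)" for v
  have P: "P v \<in> set xs" "(P v, v) \<in> succ" if "v \<in> set xs" for v
    using someI_ex[of "\<lambda>u. u \<in> set xs \<and> (u, v) \<in> succ"] cycle_pred[OF that] unfolding P_def by blast+
  have inj: "inj_on P (set xs)" using P succ_unique by (metis inj_onI)
  have Pimg: "P ` set xs = set xs" using inj P by (intro endo_inj_surj) auto
  have "P ` (set xs - X) \<subseteq> set xs - X" using P cl by blast
  then have "P ` (set xs - X) = set xs - X"
    by (intro endo_inj_surj) (auto intro: inj_on_subset[OF inj])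
  then have "P ` X = X" using Pimg inj X(1)
    by (metis Diff_Diff_Int Diff_subset inf.absorb_iff2 inj_on_image_set_diff)
  then have cl': "u \<in> X" if "v \<in> X" "u \<in> set xs" "(u, v) \<in> succ" for u v
  proof -
    obtain u' where "P u' = u" "u' \<in> set xs" using Pimg \<open>u \<in> set xs\<close> by (metis imageE)
    then have "u' = v" using P succ_unique that by blast
    then show ?thesis using \<open>P ` X = X\<close> \<open>P u' = u\<close> that by blast
  qed
  obtain x where "x \<in> X" using X by blast
  then obtain i where i: "i < length xs" "xs ! i \<in> X" using X by (metis in_set_conv_nth subsetD)
  have "set xs \<subseteq> X"
  proof (rule cycle_edges_connected[OF _ i])
    fix i assume i: "i < length xs" "xs ! i \<in> X"
    have "Suc i mod length xs < length xs" using i by (intro mod_less_divisor) auto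
    then have s: "xs ! (Suc i mod length xs) \<in> set xs" by simp
    have "{xs ! i, xs ! (Suc i mod length xs)} \<in> F"
      using i cyc unfolding cycle_edges_def by blast
    then show "xs ! (Suc i mod length xs) \<in> X"
      using edge_succ cl cl' i s by blast
  qed
  then show ?thesis using X by blast
qed

end

lemma cycle_in_cases:
  assumes "cycle_in F C"
  obtains xs where "C \<subseteq> F" "distinct xs" "3 \<le> length xs" "C = cycle_edges xs"
  using assms unfolding cycle_in_def by blast

text \<open>Induction along the undirected path. An edge directed backwards prolongs the directed
  walk to the cycle by a first step. An edge directed forwards either starts on the cycle and stays
  on it, or is the first step of the walk, as out-edges are unique.\<close>

lemma reaches_cycle:
  assumes cyc: "C \<subseteq> F" "distinct xs" "3 \<le> length xs" "C = cycle_edges xs"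
    and "x \<in> set xs" "(x, y) \<in> (adjacency F)\<^sup>*"
  shows "\<exists>z\<in>set xs. (y, z) \<in> succ\<^sup>*"
  using assms(6)
proof (induction rule: rtrancl_induct)
  case base then show ?case using assms by blast
next
  case (step y y')
  then obtain z where z: "z \<in> set xs" "(y, z) \<in> succ\<^sup>*" by blast
  from step.hyps have "{y, y'} \<in> F" by (auto simp: adjacency_def)
  then consider "(y, y') \<in> succ" | "(y', y) \<in> succ" using edge_succ by blast
  then show ?case
  proof cases
    case 1
    from z(2) show ?thesis
    proof (cases rule: converse_rtranclE)
      case base then show ?thesis using cycle_succ[OF cyc _ 1] z by blast
    next
      case (step y'') then show ?thesis using succ_unique[OF 1] z by blast
    qed
  next
    case 2 then show ?thesis using z by (meson converse_rtrancl_into_rtrancl)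
  qed
qed

text \<open>The directed walk from \<open>y\<close> reaches \<open>C\<close> but cannot leave
  \<open>C'\<close>, so the cycles share a vertex. Their common vertices are closed under
  \<open>succ\<close> and therefore make up both cycles; equal tails then give equal edge
  sets.\<close>

lemma unique_cycle:
  assumes C: "cycle_in F C" and C': "cycle_in F C'"
    and "x \<in> \<Union>C" "y \<in> \<Union>C'" and xy: "(x, y) \<in> (adjacency F)\<^sup>*"
  shows "C = C'"
proof -
  obtain xs where cyc: "C \<subseteq> F" "distinct xs" "3 \<le> length xs" "C = cycle_edges xs"
    using C by (rule cycle_in_cases)
  obtain ys where cyc': "C' \<subseteq> F" "distinct ys" "3 \<le> length ys" "C' = cycle_edges ys"
    using C' by (rule cycle_in_cases)
  have "x \<in> set xs" "y \<in> set ys" using assms Union_cycle_edges cyc cyc' by blast+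
  obtain z where z: "z \<in> set xs" "(y, z) \<in> succ\<^sup>*" using reaches_cycle[OF cyc \<open>x \<in> set xs\<close> xy] by blast
  from z(2) have "z \<in> set ys"
    by (induction rule: rtrancl_induct) (use \<open>y \<in> set ys\<close> cycle_succ(2)[OF cyc'] in blast)+
  let ?X = "set xs \<inter> set ys"
  have cl: "v \<in> ?X" if "u \<in> ?X" "(u, v) \<in> succ" for u v
    using that cycle_succ(2)[OF cyc] cycle_succ(2)[OF cyc'] by blast
  have "?X = set xs"
    by (rule cycle_closed_subset[OF cyc]) (use z \<open>z \<in> set ys\<close> cl in blast)+
  moreover have "?X = set ys"
    by (rule cycle_closed_subset[OF cyc']) (use z \<open>z \<in> set ys\<close> cl in blast)+
  ultimately have "tail ` C = tail ` C'"
    using cycle_vertices_tails[OF cyc] cycle_vertices_tails[OF cyc'] by simp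
  then show ?thesis using tail_inj cyc(1) cyc'(1) by (simp add: inj_on_image_eq_iff)
qed

lemma pseudoforest_out_degree_one:
  assumes sg: "simple_graph V F"
  shows "pseudoforest V F"
  unfolding pseudoforest_def
proof (intro conjI ballI Uniq_I sg)
  fix K C C'
  assume K: "K \<in> components V F" and C: "cycle_in {e \<in> F. e \<subseteq> K} C" "cycle_in {e \<in> F. e \<subseteq> K} C'"
  then have c: "cycle_in F C" "cycle_in F C'" "\<Union>C \<subseteq> K" "\<Union>C' \<subseteq> K"
    unfolding cycle_in_def by blast+
  have "\<Union>D \<noteq> {}" if "cycle_in F D" for D
  proof -
    obtain xs where xs: "3 \<le> length xs" "D = cycle_edges xs" using \<open>cycle_in F D\<close> by (rule cycle_in_cases)
    then have "xs \<noteq> []" by auto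
    then show ?thesis using Union_cycle_edges[OF xs(1)] xs(2) by simp
  qed
  then have "\<Union>C \<noteq> {}" "\<Union>C' \<noteq> {}" using c by blast+
  then obtain x y where xy: "x \<in> \<Union>C" "y \<in> \<Union>C'" by blast
  then have "x \<in> K" "y \<in> K" using c by blast+
  obtain a where a: "(a, x) \<in> (adjacency F)\<^sup>*" "(a, y) \<in> (adjacency F)\<^sup>*"
    using K \<open>x \<in> K\<close> \<open>y \<in> K\<close> unfolding components_def quotient_def by blast
  have "sym (adjacency F)" by (auto simp: adjacency_def sym_def insert_commute)
  then have "(x, y) \<in> (adjacency F)\<^sup>*"
    using a by (meson rtrancl_trans sym_rtrancl symD)
  then show "C = C'" using unique_cycle c xy by blast
qed

end

section \<open>Running time bounds for programs\<close>

text \<open>A total-correctness assertion: an execution must exist, so termination and the fit of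
  all values into words are part of it. The postcondition also sees the running time.\<close>

definition run :: "nat \<Rightarrow> com \<Rightarrow> state \<Rightarrow> (nat \<Rightarrow> state \<Rightarrow> bool) \<Rightarrow> bool" where
  "run w c s Q \<longleftrightarrow> (\<exists>t s'. exec w c s t s' \<and> Q t s')"

lemma run_mono: "run w c s P \<Longrightarrow> (\<And>t s'. P t s' \<Longrightarrow> Q t s') \<Longrightarrow> run w c s Q"
  unfolding run_def by blast

text \<open>
  Without this congruence rule the simplifier rewrites the postcondition before the first
  instruction has been executed, which takes exponential time.
\<close>

lemma run_weak_cong: "s = s' \<Longrightarrow> run w c s Q = run w c s' Q"
  by simp

text \<open>This and the following equivalences compute weakest preconditions, so loop-free code is
  executed symbolically by simplification.\<close>

lemma run_Skip [simp]: "run w Skip s Q \<longleftrightarrow> Q 1 s"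
  unfolding run_def by (blast intro: exec.Skip elim: exec.cases[of w Skip])

lemma run_Move [simp]: "run w (Move r p) s Q \<longleftrightarrow>
    operand_val p s < 2 ^ w \<and> Q 1 (s\<lparr>reg := (reg s)(r := operand_val p s)\<rparr>)"
  unfolding run_def
  by (fastforce simp: set_reg_def intro: exec.Move elim: exec.cases)

lemma run_Arith [simp]: "run w (Arith r f p q) s Q \<longleftrightarrow>
    arith_val f (operand_val p s) (operand_val q s) < 2 ^ w \<and>
    Q 1 (s\<lparr>reg := (reg s)(r := arith_val f (operand_val p s) (operand_val q s))\<rparr>)"
  unfolding run_def
  by (fastforce simp: set_reg_def intro: exec.Arith elim: exec.cases)

lemma run_Load [simp]: "run w (Load r a p) s Q \<longleftrightarrow>
    operand_val p s < 2 ^ w \<and> Q 1 (s\<lparr>reg := (reg s)(r := arr s a (operand_val p s))\<rparr>)"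
  unfolding run_def
  by (fastforce simp: set_reg_def intro: exec.Load elim: exec.cases)

lemma run_Store [simp]: "run w (Store a p q) s Q \<longleftrightarrow>
    operand_val p s < 2 ^ w \<and> operand_val q s < 2 ^ w \<and>
    Q 1 (s\<lparr>arr := (arr s)(a := (arr s a)(operand_val p s := operand_val q s))\<rparr>)"
  unfolding run_def
  by (fastforce simp: set_arr_def intro: exec.Store elim: exec.cases)

lemma run_Seq [simp]: "run w (Seq c1 c2) s Q \<longleftrightarrow>
    run w c1 s (\<lambda>t1 s1. run w c2 s1 (\<lambda>t2 s2. Q (t1 + t2) s2))"
  unfolding run_def by (blast intro: exec.Seq elim: exec.cases[of w "Seq c1 c2"])

lemma run_If [simp]: "run w (If b p q c1 c2) s Q \<longleftrightarrow>
    (if comparison_val b (operand_val p s) (operand_val q s)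
     then run w c1 s (\<lambda>t. Q (1 + t)) else run w c2 s (\<lambda>t. Q (1 + t)))"
  unfolding run_def
  by (cases "comparison_val b (operand_val p s) (operand_val q s)"; simp only: if_True if_False)
    (blast intro: exec.IfTrue exec.IfFalse elim: exec.cases[of w "If b p q c1 c2"])+

text \<open>The measure \<open>f\<close> is a potential that pays for the running time of the whole loop.\<close>

lemma run_While:
  assumes "I s"
    and step: "\<And>s. I s \<Longrightarrow> comparison_val b (operand_val p s) (operand_val q s) \<Longrightarrow>
      run w c s (\<lambda>t s'. I s' \<and> 1 + t + f s' \<le> f s)"
    and post: "\<And>t s'. I s' \<Longrightarrow> \<not> comparison_val b (operand_val p s') (operand_val q s') \<Longrightarrow>
      t + f s' \<le> 1 + f s \<Longrightarrow> Q t s'"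
  shows "run w (While b p q c) s Q"
proof -
  have "\<exists>t s'. exec w (While b p q c) s t s' \<and> I s' \<and>
      \<not> comparison_val b (operand_val p s') (operand_val q s') \<and> t + f s' \<le> 1 + f s"
    using assms(1)
  \<comment> \<open>Every pass costs at least one unit for the test, so \<open>f\<close> strictly
    decreases and also proves termination.\<close>
  proof (induction "f s" arbitrary: s rule: less_induct)
    case less
    show ?case
    proof (cases "comparison_val b (operand_val p s) (operand_val q s)")
      case True
      then obtain t1 s1 where 1: "exec w c s t1 s1" "I s1" "1 + t1 + f s1 \<le> f s"
        using step[OF less.prems] unfolding run_def by blast
      then obtain t2 s2 where 2: "exec w (While b p q c) s1 t2 s2" "I s2"
          "\<not> comparison_val b (operand_val p s2) (operand_val q s2)" "t2 + f s2 \<le> 1 + f s1"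
        using less.hyps[of s1] by force
      have "exec w (While b p q c) s (1 + t1 + t2) s2" using True 1 2 by (blast intro: exec.WhileTrue)
      then show ?thesis using 1 2 by (intro exI[of _ "1 + t1 + t2"] exI[of _ s2]) simp
    next
      case False
      then show ?thesis using less.prems exec.WhileFalse[OF False] by (intro exI[of _ 1] exI[of _ s]) simp
    qed
  qed
  then show ?thesis unfolding run_def using post by blast
qed

definition For :: "nat \<Rightarrow> operand \<Rightarrow> com \<Rightarrow> com" where
  "For r p c = Seq (Move r (Imm 0)) (While Lt (Reg r) p (Seq c (Arith r Add (Reg r) (Imm 1))))"

text \<open>The bound \<open>p\<close> is read anew before every pass, so the invariant has to fix
  its value. Each pass costs the body, one test and one increment; the final 2 pays for the
  initialisation and the last test.\<close>

lemma run_For: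
  assumes N: "N < 2 ^ w"
    and bound: "\<And>i s. I i s \<Longrightarrow> operand_val p s = N"
    and init: "I 0 (s\<lparr>reg := (reg s)(r := 0)\<rparr>)"
    and step: "\<And>i s. I i s \<Longrightarrow> i < N \<Longrightarrow> reg s r = i \<Longrightarrow>
      run w c s (\<lambda>t s'. t \<le> B \<and> reg s' r = i \<and> I (Suc i) (s'\<lparr>reg := (reg s')(r := Suc i)\<rparr>))"
    and post: "\<And>t s'. I N s' \<Longrightarrow> t \<le> (B + 2) * N + 2 \<Longrightarrow> Q t s'"
  shows "run w (For r p c) s Q"
proof -
  let ?J = "\<lambda>s. I (reg s r) s \<and> reg s r \<le> N"
  let ?f = "\<lambda>s. (B + 2) * (N - reg s r)"
  show ?thesis unfolding For_def run_Seq run_Move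
  proof (intro conjI run_While[where I = ?J and f = ?f])
    fix s assume s: "?J s" "comparison_val Lt (operand_val (Reg r) s) (operand_val p s)"
    then have lt: "reg s r < N" using bound[OF conjunct1[OF s(1)]] by simp
    show "run w (Seq c (Arith r Add (Reg r) (Imm 1))) s (\<lambda>t s'. ?J s' \<and> 1 + t + ?f s' \<le> ?f s)"
      unfolding run_Seq
    proof (rule run_mono[OF step[OF conjunct1[OF s(1)] lt refl]], clarify)
      fix t s' assume t: "t \<le> B" "reg s' r = reg s r"
        and I: "I (Suc (reg s r)) (s'\<lparr>reg := (reg s')(r := Suc (reg s r))\<rparr>)"
      obtain d where d: "N = reg s r + Suc d" using lt less_iff_Suc_add by auto
      show "run w (Arith r Add (Reg r) (Imm 1)) s'
          (\<lambda>t2 s2. ?J s2 \<and> 1 + (t + t2) + ?f s2 \<le> ?f s)"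
        using t I lt N by (auto simp: d)
    qed
  next
    fix t s' assume "?J s'" "\<not> comparison_val Lt (operand_val (Reg r) s') (operand_val p s')"
      and t: "t + ?f s' \<le> 1 + ?f (s\<lparr>reg := (reg s)(r := operand_val (Imm 0) s)\<rparr>)"
    then have "I N s'" using bound by auto
    then show "Q (1 + t) s'" using t by (intro post) auto
  qed (use init in auto)
qed

section \<open>Density, peeling and push-relabel\<close>

lemma card_less_Suc_if:
  "card {i. i < Suc N \<and> P i} = card {i. i < N \<and> P i} + (if P N then 1 else 0)"
proof -
  have "{i. i < Suc N \<and> P i} = (if P N then insert N else id) {i. i < N \<and> P i}"
    by (auto simp: less_Suc_eq)
  then show ?thesis by simp
qed

lemma card_fibres:
  assumes "finite J" "finite X"
  shows "card {j \<in> J. f j \<in> X} = (\<Sum>x\<in>X. card {j \<in> J. f j = x})"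
proof -
  have "{j \<in> J. f j \<in> X} = (\<Union>x\<in>X. {j \<in> J. f j = x})" by auto
  then show ?thesis using assms by (simp only:) (intro card_UN_disjoint; auto)
qed

lemma finite_densities:
  assumes "finite V" "simple_graph V E"
  shows "finite {real (card E') / real (card V') | V' E'. V' \<noteq> {} \<and> subgraph V' E' V E}"
proof -
  have "finite E" using assms(2) finite_subset[of E "Pow V"] by (auto simp: simple_graph_def)
  then have "finite ((\<lambda>(V', E'). real (card E') / real (card V')) ` (Pow V \<times> Pow E))"
    using assms by simp
  then show ?thesis by (rule finite_subset[rotated]) (auto simp: subgraph_def)
qed

section \<open>Half-edges of an edge list, and bounds on the maximum density\<close>

locale edge_list =
  fixes n :: nat and E :: "nat set set" and es :: "(nat \<times> nat) list"
  assumes simple: "simple_graph {0..<n} E"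
    and lists: "lists_edges es E"
    and n_ge: "2 \<le> n" and m_ge: "n \<le> length es"
begin

abbreviation m :: nat where "m \<equiv> length es"

abbreviation dens :: real where "dens \<equiv> max_density {0..<n} E"

text \<open>Edge \<open>j\<close> has the half-edges \<open>2 * j\<close> and \<open>2 * j + 1\<close>.\<close>

definition origin :: "nat \<Rightarrow> nat" where
  "origin i = (if even i then fst (es ! (i div 2)) else snd (es ! (i div 2)))"

definition target :: "nat \<Rightarrow> nat" where
  "target i = (if even i then snd (es ! (i div 2)) else fst (es ! (i div 2)))"

lemma origin_simps [simp]: "origin (2 * j) = fst (es ! j)" "origin (Suc (2 * j)) = snd (es ! j)"
  and target_simps [simp]: "target (2 * j) = snd (es ! j)" "target (Suc (2 * j)) = fst (es ! j)"
  by (simp_all add: origin_def target_def)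

lemma edge_mem: "j < m \<Longrightarrow> ends (es ! j) \<in> E"
  using lists unfolding lists_edges_def by auto

lemma ends_less: "j < m \<Longrightarrow> fst (es ! j) < n" "j < m \<Longrightarrow> snd (es ! j) < n"
  and ends_neq: "j < m \<Longrightarrow> fst (es ! j) \<noteq> snd (es ! j)"
proof -
  assume "j < m"
  then have "ends (es ! j) \<subseteq> {0..<n}" "card (ends (es ! j)) = 2"
    using edge_mem simple unfolding simple_graph_def by blast+
  then show "fst (es ! j) < n" "snd (es ! j) < n" "fst (es ! j) \<noteq> snd (es ! j)"
    by (auto simp: ends_def)
qed

lemma half_edge_div: "i < 2 * m \<Longrightarrow> i div 2 < m" by linarith

lemma origin_less: "i < 2 * m \<Longrightarrow> origin i < n"
  and target_less: "i < 2 * m \<Longrightarrow> target i < n"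
  and origin_neq_target: "i < 2 * m \<Longrightarrow> origin i \<noteq> target i"
  and ends_half_edge: "ends (es ! (i div 2)) = {origin i, target i}"
proof -
  assume "i < 2 * m"
  note j = half_edge_div[OF this]
  show "origin i < n" "target i < n" "origin i \<noteq> target i"
    using ends_less[OF j] ends_neq[OF j] by (auto simp: origin_def target_def)
next
  show "ends (es ! (i div 2)) = {origin i, target i}"
    by (simp add: origin_def target_def ends_def insert_commute)
qed

lemma half_edge_of_end:
  assumes "j < m" "u \<in> ends (es ! j)"
  obtains i where "i < 2 * m" "i div 2 = j" "origin i = u"
proof -
  from assms(2) consider "u = fst (es ! j)" | "u = snd (es ! j)" by (auto simp: ends_def)
  then show ?thesis
  proof cases
    case 1 then show ?thesis using that[of "2 * j"] assms(1) by simp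
  next
    case 2 then show ?thesis using that[of "Suc (2 * j)"] assms(1) by simp
  qed
qed

lemma half_edge_eq:
  assumes "i < 2 * m" "i' < 2 * m" "i div 2 = i' div 2" "origin i = origin i'"
  shows "i = i'"
proof -
  have "even i \<longleftrightarrow> even i'"
    using assms ends_neq[OF half_edge_div[OF assms(1)]] by (auto simp: origin_def split: if_splits)
  then show ?thesis using assms(3) by (metis dvd_mult_div_cancel odd_two_times_div_two_succ)
qed

lemma half_edge_sibling:
  assumes "i < 2 * m" "i' < 2 * m" "i div 2 = i' div 2" "i \<noteq> i'"
  shows "origin i' = target i" "target i' = origin i"
proof -
  have "origin i \<noteq> origin i'" using half_edge_eq assms by blast
  moreover have "{origin i, target i} = {origin i', target i'}"
    using ends_half_edge assms(3) by metis
  ultimately show "origin i' = target i" "target i' = origin i" by (auto simp: doubleton_eq_iff)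
qed

definition inside :: "nat set \<Rightarrow> nat set" where
  "inside S = {j. j < m \<and> ends (es ! j) \<subseteq> S}"

lemma finite_inside [simp]: "finite (inside S)" by (simp add: inside_def)

lemma inside_empty [simp]: "inside {} = {}" by (simp add: inside_def ends_def)

lemma inside_all: "inside {0..<n} = {..<m}"
proof -
  have "ends (es ! j) \<subseteq> {0..<n}" if "j < m" for j using ends_less[OF that] by (simp add: ends_def)
  then show ?thesis unfolding inside_def by blast
qed

text \<open>The list is free of repetitions, so counting indices amounts to counting edges.\<close>

lemma card_inside: "card (inside S) = card {e \<in> E. e \<subseteq> S}"
proof -
  have inj: "inj_on (\<lambda>j. ends (es ! j)) (inside S)"
    using lists unfolding lists_edges_def inside_def distinct_conv_nth inj_on_def by auto
  have E: "e \<in> E \<longleftrightarrow> (\<exists>j<m. e = ends (es ! j))" for e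
    using lists unfolding lists_edges_def by (metis edge_mem in_set_conv_nth length_map nth_map)
  have "{e \<in> E. e \<subseteq> S} = (\<lambda>j. ends (es ! j)) ` inside S"
    unfolding inside_def E by auto
  then show ?thesis using card_image[OF inj] by simp
qed

lemma finite_E: "finite E"
  using lists unfolding lists_edges_def by auto

lemma card_inside_le:
  assumes "S \<subseteq> {0..<n}"
  shows "real (card (inside S)) \<le> dens * real (card S)"
proof (cases "S = {}")
  case False
  have "subgraph S {e \<in> E. e \<subseteq> S} {0..<n} E"
    using assms simple finite_subset[OF assms] by (auto simp: subgraph_def simple_graph_def)
  then have "real (card {e \<in> E. e \<subseteq> S}) / real (card S) \<le> dens"
    unfolding max_density_def using False simple
    by (intro Max_ge finite_densities) auto
  moreover have "card S > 0" using False assms finite_subset[of S "{0..<n}"] by (auto simp: card_gt_0_iff)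
  ultimately show ?thesis unfolding card_inside by (simp add: field_simps)
qed simp

text \<open>Only induced subgraphs need to be bounded: no subgraph has more edges than the induced
  one on the same vertices.\<close>

lemma max_density_le:
  assumes B: "\<And>S. S \<subseteq> {0..<n} \<Longrightarrow> real (card (inside S)) \<le> B * real (card S)"
  shows "dens \<le> B"
proof -
  let ?D = "{real (card E') / real (card V') | V' E'. V' \<noteq> {} \<and> subgraph V' E' {0..<n} E}"
  have "subgraph {0..<n} {} {0..<n} E" by (simp add: subgraph_def simple_graph_def)
  moreover have "{0..<n} \<noteq> {}" using n_ge by simp
  ultimately have "?D \<noteq> {}" by blast
  moreover have "x \<le> B" if x: "x \<in> ?D" for x
  proof -
    from x obtain V' E' where V': "x = real (card E') / real (card V')" "V' \<noteq> {}"
      and sub: "subgraph V' E' {0..<n} E" by blast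
    then have sub': "V' \<subseteq> {0..<n}" "E' \<subseteq> {e \<in> E. e \<subseteq> V'}"
      by (auto simp: subgraph_def simple_graph_def)
    have "card E' \<le> card (inside V')"
      unfolding card_inside using sub' finite_E by (intro card_mono) auto
    also have "real \<dots> \<le> B * real (card V')" using B sub' by blast
    finally have "real (card E') \<le> B * real (card V')" by simp
    moreover have "card V' > 0" using V'(2) sub' finite_subset[of V' "{0..<n}"] by (auto simp: card_gt_0_iff)
    ultimately show ?thesis unfolding V'(1) by (simp add: field_simps)
  qed
  ultimately show ?thesis
    unfolding max_density_def using finite_densities[of "{0..<n}" E] simple by (subst Max_le_iff) auto
qed

text \<open>The whole graph already has density \<open>m / n\<close>.\<close>

lemma one_le_dens: "1 \<le> dens"
proof -
  have "real n \<le> dens * real n" using card_inside_le[of "{0..<n}"] m_ge by (simp add: inside_all)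
  then show ?thesis using n_ge by simp
qed

text \<open>A crude bound, from which the density estimates and the tested values of
  \<open>k\<close> are seen to fit into words.\<close>

lemma dens_le_m: "dens \<le> real m"
proof (rule max_density_le)
  fix S assume S: "S \<subseteq> {0..<n}"
  show "real (card (inside S)) \<le> real m * real (card S)"
  proof (cases "S = {}")
    case False
    then have "1 \<le> card S" using S finite_subset[of S "{0..<n}"] by (simp add: Suc_le_eq card_gt_0_iff)
    moreover have "card (inside S) \<le> card {..<m}" by (rule card_mono) (auto simp: inside_def)
    ultimately have "card (inside S) \<le> m * card S" by (metis card_lessThan le_trans mult.right_neutral mult_le_mono2)
    then show ?thesis by (metis of_nat_le_iff of_nat_mult)
  qed simp
qed

subsection \<open>Peeling\<close>

definition inner_degree :: "nat set \<Rightarrow> nat \<Rightarrow> nat" where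
  "inner_degree U v = card {i. i < 2 * m \<and> i div 2 \<in> inside U \<and> origin i = v}"

lemma sum_inner_degree:
  assumes "finite X"
  shows "(\<Sum>v\<in>X. inner_degree U v) = card {i. i < 2 * m \<and> i div 2 \<in> inside U \<and> origin i \<in> X}"
  using card_fibres[of "{i. i < 2 * m \<and> i div 2 \<in> inside U}" X origin] assms
  by (simp add: inner_degree_def conj_assoc)

lemma sum_inner_degree_le:
  assumes "finite X"
  shows "(\<Sum>v\<in>X. inner_degree U v) \<le> 2 * card (inside U)"
proof -
  have "{i. i < 2 * m \<and> i div 2 \<in> inside U \<and> origin i \<in> X} \<subseteq>
      (\<lambda>j. 2 * j) ` inside U \<union> (\<lambda>j. 2 * j + 1) ` inside U"
  proof
    fix i assume "i \<in> {i. i < 2 * m \<and> i div 2 \<in> inside U \<and> origin i \<in> X}"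
    moreover have "i = 2 * (i div 2) \<or> i = 2 * (i div 2) + 1" by linarith
    ultimately show "i \<in> (\<lambda>j. 2 * j) ` inside U \<union> (\<lambda>j. 2 * j + 1) ` inside U" by blast
  qed
  then have "(\<Sum>v\<in>X. inner_degree U v) \<le> card ((\<lambda>j. 2 * j) ` inside U \<union> (\<lambda>j. 2 * j + 1) ` inside U)"
    unfolding sum_inner_degree[OF assms] by (intro card_mono) auto
  also have "\<dots> \<le> card (inside U) + card (inside U)"
    by (meson add_mono card_Un_le card_image_le finite_inside le_trans)
  finally show ?thesis by simp
qed

text \<open>The inner degrees sum to at most twice the number of inner edges, which is less than
  \<open>2 * (r + 1) * card U\<close>. So fewer than half of the vertices can have inner degree
  \<open>4 * (r + 1)\<close> or more.\<close>

lemma peel_halves: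
  assumes U: "finite U" "U \<noteq> {}" and r: "card (inside U) div card U \<le> r"
  shows "2 * card {v \<in> U. 4 * r + 4 \<le> inner_degree U v} < card U"
proof -
  let ?X = "{v \<in> U. 4 * r + 4 \<le> inner_degree U v}"
  have "(4 * r + 4) * card ?X \<le> (\<Sum>v\<in>?X. inner_degree U v)"
    using sum_bounded_below[of ?X "4 * r + 4" "inner_degree U"] by (simp add: mult.commute)
  also have "\<dots> \<le> 2 * card (inside U)" using U by (intro sum_inner_degree_le) simp
  also have "\<dots> < 2 * ((r + 1) * card U)"
  proof -
    have "card U > 0" using U by (simp add: card_gt_0_iff)
    \<comment> \<open>The density was rounded down, so adding 1 makes the bound strict.\<close>
    then have "card (inside U) < (card (inside U) div card U + 1) * card U"
      by (metis Suc_eq_plus1 dividend_less_div_times mult_Suc add.commute)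
    also have "\<dots> \<le> (r + 1) * card U" using r by (intro mult_le_mono1) simp
    finally show ?thesis by simp
  qed
  finally have "(2 * (r + 1)) * (2 * card ?X) < (2 * (r + 1)) * card U" by (simp add: algebra_simps)
  then show ?thesis by (simp only: mult_less_cancel1)
qed

text \<open>
  Every edge that no longer lies within \<open>U\<close> is charged to the first of its endpoints that was
  removed, and every vertex receives at most \<open>T\<close> charges.
\<close>

definition charged :: "nat set \<Rightarrow> nat \<Rightarrow> bool" where
  "charged U T \<longleftrightarrow> (\<forall>S\<subseteq>{0..<n}. card (inside S - inside U) \<le> T * card (S - U))"

lemma charged_all: "charged {0..<n} T"
proof -
  have "inside S \<subseteq> inside {0..<n}" for S unfolding inside_all by (auto simp: inside_def)
  then have "inside S - inside {0..<n} = {}" for S by blast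
  then show ?thesis unfolding charged_def by (simp only:) simp
qed

lemma charged_mono:
  assumes "charged U T" "T \<le> T'"
  shows "charged U T'"
  unfolding charged_def
proof (intro allI impI)
  fix S assume "S \<subseteq> {0..<n}"
  then have "card (inside S - inside U) \<le> T * card (S - U)" using assms(1) by (simp add: charged_def)
  also have "\<dots> \<le> T' * card (S - U)" using assms(2) by simp
  finally show "card (inside S - inside U) \<le> T' * card (S - U)" .
qed

text \<open>An edge of \<open>S\<close> lost in this round has an end in
  \<open>S \<inter> (U - U')\<close>, so the inner degrees of these vertices bound the number of
  lost edges. The vertices are disjoint from those charged earlier, so the two bounds add
  up.\<close>

lemma charged_peel:
  assumes U: "charged U T" "U' \<subseteq> U" "finite U"
    and low: "\<And>v. v \<in> U - U' \<Longrightarrow> inner_degree U v \<le> T"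
  shows "charged U' T"
  unfolding charged_def
proof (intro allI impI)
  fix S assume S: "S \<subseteq> {0..<n}"
  let ?X = "S \<inter> (U - U')"
  let ?I = "{i. i < 2 * m \<and> i div 2 \<in> inside U \<and> origin i \<in> ?X}"
  have fX: "finite ?X" using U(3) by blast
  have "inside S - inside U' \<subseteq> (inside S - inside U) \<union> (\<lambda>i. i div 2) ` ?I"
  proof
    fix j assume j: "j \<in> inside S - inside U'"
    then obtain v where v: "v \<in> ends (es ! j)" "v \<notin> U'" "j < m" by (auto simp: inside_def)
    then obtain i where i: "i < 2 * m" "i div 2 = j" "origin i = v" by (metis half_edge_of_end)
    have "v \<in> S" using j v by (auto simp: inside_def)
    show "j \<in> (inside S - inside U) \<union> (\<lambda>i. i div 2) ` ?I"
    proof (cases "j \<in> inside U")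
      case True
      then have "v \<in> U" using v by (auto simp: inside_def)
      then have "i \<in> ?I" using i True v \<open>v \<in> S\<close> by simp
      then show ?thesis using i by blast
    qed (use j in simp)
  qed
  then have "card (inside S - inside U') \<le> card ((inside S - inside U) \<union> (\<lambda>i. i div 2) ` ?I)"
    by (intro card_mono) auto
  also have "\<dots> \<le> card (inside S - inside U) + card ((\<lambda>i. i div 2) ` ?I)" by (rule card_Un_le)
  also have "card ((\<lambda>i. i div 2) ` ?I) \<le> card ?I" by (rule card_image_le) simp
  also have "card ?I = (\<Sum>v\<in>?X. inner_degree U v)" using sum_inner_degree[OF fX] by simp
  also have "\<dots> \<le> T * card ?X" using sum_bounded_above[of ?X "inner_degree U" T] low
    by (simp add: mult.commute)
  also have "card (inside S - inside U) \<le> T * card (S - U)" using U S by (simp add: charged_def)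
  finally have "card (inside S - inside U') \<le> T * (card (S - U) + card ?X)"
    by (simp add: algebra_simps)
  also have "card (S - U) + card ?X = card ((S - U) \<union> ?X)"
    using fX finite_subset[OF S] by (intro card_Un_disjoint[symmetric]) auto
  also have "(S - U) \<union> ?X = S - U'" using U by blast
  finally show "card (inside S - inside U') \<le> T * card (S - U')" .
qed

lemma charged_empty:
  assumes "charged {} T"
  shows "dens \<le> real T"
proof (rule max_density_le)
  fix S assume "S \<subseteq> {0..<n}"
  then have "card (inside S) \<le> T * card S" using assms unfolding charged_def by (metis Diff_empty inside_empty)
  then show "real (card (inside S)) \<le> real T * real (card S)" by (metis of_nat_le_iff of_nat_mult)
qed

subsection \<open>Pushing and relabelling\<close>

text \<open>\<open>p\<close> is a shifted link to the largest half-edge below \<open>N\<close> that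
  starts at \<open>u\<close>, or 0 if there is none. The same notion describes list heads
  (\<open>N = 2 * m\<close>) and links to the next element (\<open>N = i\<close>), with lists in
  decreasing order.\<close>

definition last_half_edge :: "nat \<Rightarrow> nat \<Rightarrow> nat \<Rightarrow> bool" where
  "last_half_edge N u p \<longleftrightarrow>
     p \<le> N \<and> (p = 0 \<or> origin (p - 1) = u) \<and> (\<forall>i<N. origin i = u \<longrightarrow> i < p)"

text \<open>\<open>D\<close> gives the tail of each edge and \<open>G\<close> the out-degree of each
  vertex.\<close>

definition oriented :: "(nat \<Rightarrow> nat) \<Rightarrow> (nat \<Rightarrow> nat) \<Rightarrow> bool" where
  "oriented D G \<longleftrightarrow> (\<forall>j<m. D j \<in> ends (es ! j)) \<and> (\<forall>u<n. G u = card {j. j < m \<and> D j = u})"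

definition pointers :: "(nat \<Rightarrow> nat) \<Rightarrow> bool" where
  "pointers C \<longleftrightarrow> (\<forall>u<n. C u \<le> 2 * m \<and> (C u = 0 \<or> origin (C u - 1) = u))"

text \<open>Half-edges \<open>i\<close> at \<open>u\<close> with \<open>C u \<le> i\<close> have
  been passed by the pointer of \<open>u\<close>. A passed half-edge that leaves its tail admits no
  push, as the label does not drop along it.\<close>

definition labelled :: "nat \<Rightarrow> (nat \<Rightarrow> nat) \<Rightarrow> (nat \<Rightarrow> nat) \<Rightarrow> (nat \<Rightarrow> nat) \<Rightarrow> (nat \<Rightarrow> nat) \<Rightarrow> bool" where
  "labelled k D C G H \<longleftrightarrow>
     (\<forall>i<2 * m. D (i div 2) = origin i \<longrightarrow>
        H (origin i) \<le> Suc (H (target i)) \<and> (C (origin i) \<le> i \<longrightarrow> H (origin i) \<le> H (target i))) \<and>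
     (\<forall>u<n. 0 < H u \<longrightarrow> k \<le> G u)"

text \<open>Below the limit \<open>L\<close>, vertex \<open>u\<close> can be relabelled
  \<open>L - H u\<close> more times. Each relabelling counts once and restarts a scan of all
  half-edges at \<open>u\<close>; the second summand is what remains of the current scan.\<close>

definition potential :: "nat \<Rightarrow> (nat \<Rightarrow> nat) \<Rightarrow> (nat \<Rightarrow> nat) \<Rightarrow> nat" where
  "potential L C H = (\<Sum>u<n. (L - H u) * Suc (card {i. i < 2 * m \<and> origin i = u}) +
     card {i. i < C u \<and> origin i = u})"

lemma sum_upd_less:
  fixes f g :: "nat \<Rightarrow> nat"
  assumes "x < n" "f x < g x" "\<And>u. u < n \<Longrightarrow> u \<noteq> x \<Longrightarrow> f u = g u"
  shows "(\<Sum>u<n. f u) < (\<Sum>u<n. g u)"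
proof (rule sum_strict_mono_ex1)
  show "\<forall>u\<in>{..<n}. f u \<le> g u" using assms by (metis lessThan_iff less_imp_le order_refl)
  show "\<exists>u\<in>{..<n}. f u < g u" using assms by blast
qed simp

text \<open>The last claim says that no half-edge is skipped: those at \<open>x\<close> from the new
  pointer on are \<open>i\<close> and those passed before.\<close>

lemma next_half_edge:
  assumes C: "pointers C" "x < n" "C x = Suc i" and p: "last_half_edge i x p"
  shows "i < 2 * m" "origin i = x" "pointers (C(x := p))"
    "potential L (C(x := p)) H < potential L C H"
    "i' < 2 * m \<Longrightarrow> origin i' = x \<Longrightarrow> p \<le> i' \<Longrightarrow> i' = i \<or> C x \<le> i'"
proof -
  show i: "i < 2 * m" "origin i = x" using C unfolding pointers_def by force+
  show "pointers (C(x := p))" using C p i unfolding pointers_def last_half_edge_def by auto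
  have "card {i. i < p \<and> origin i = x} < card {i. i < C x \<and> origin i = x}"
  proof (rule psubset_card_mono)
    have "i \<in> {i. i < C x \<and> origin i = x}" "i \<notin> {i. i < p \<and> origin i = x}"
      using p i C(3) unfolding last_half_edge_def by simp_all
    moreover have "{i. i < p \<and> origin i = x} \<subseteq> {i. i < C x \<and> origin i = x}"
      using p C(3) unfolding last_half_edge_def by auto
    ultimately show "{i. i < p \<and> origin i = x} \<subset> {i. i < C x \<and> origin i = x}" by blast
  qed simp
  then show "potential L (C(x := p)) H < potential L C H"
    unfolding potential_def by (intro sum_upd_less[OF C(2)]) simp_all
  show "i' < 2 * m \<Longrightarrow> origin i' = x \<Longrightarrow> p \<le> i' \<Longrightarrow> i' = i \<or> C x \<le> i'"
    using p C(3) unfolding last_half_edge_def by (metis Suc_leI linorder_neqE_nat not_less)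
qed

text \<open>Only \<open>i\<close> itself is newly passed, and \<open>adv\<close> is the condition
  for it.\<close>

lemma labelled_advance:
  assumes C: "pointers C" "x < n" "C x = Suc i" and p: "last_half_edge i x p"
    and l: "labelled k D C G H" and adv: "D (i div 2) = x \<Longrightarrow> H x \<le> H (target i)"
  shows "labelled k D (C(x := p)) G H"
  unfolding labelled_def
proof (intro conjI allI impI)
  fix i' assume i': "i' < 2 * m" "D (i' div 2) = origin i'"
  have *: "H (origin i') \<le> Suc (H (target i'))" "C (origin i') \<le> i' \<Longrightarrow> H (origin i') \<le> H (target i')"
    using l i' unfolding labelled_def by blast+
  then show "H (origin i') \<le> Suc (H (target i'))" by blast
  assume C': "(C(x := p)) (origin i') \<le> i'"
  show "H (origin i') \<le> H (target i')"
  proof (cases "origin i' = x")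
    case True
    then consider "i' = i" | "C x \<le> i'" using next_half_edge(5)[OF C p i'(1)] C' by auto
    then show ?thesis using True * adv i' by cases auto
  qed (use C' * in simp)
next
  show "k \<le> G u" if "u < n" "0 < H u" for u using that l unfolding labelled_def by blast
qed

text \<open>After the push the edge leaves \<open>target i\<close> by the sibling of
  \<open>i\<close>, along which the label rises. As \<open>k < G x\<close>, the out-degree of
  \<open>x\<close> stays at least \<open>k\<close>.\<close>

lemma labelled_push:
  assumes C: "pointers C" "x < n" "C x = Suc i" and p: "last_half_edge i x p"
    and l: "labelled k D C G H" and "D (i div 2) = x" "H (target i) < H x" "k < G x"
  shows "labelled k (D(i div 2 := target i)) (C(x := p))
    (G(x := G x - 1, target i := Suc (G (target i)))) H"
proof -
  note ne = next_half_edge[OF C p]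
  have t: "target i < n" "target i \<noteq> x" using ne target_less origin_neq_target by metis+
  show ?thesis unfolding labelled_def
  proof (intro conjI allI impI)
    fix i' assume i': "i' < 2 * m" "(D(i div 2 := target i)) (i' div 2) = origin i'"
    have *: "H (origin i') \<le> Suc (H (target i')) \<and> ((C(x := p)) (origin i') \<le> i' \<longrightarrow> H (origin i') \<le> H (target i'))"
    proof (cases "i' div 2 = i div 2")
      case True
      then have "i' \<noteq> i" using i' t ne by auto
      then have "origin i' = target i" "target i' = x" using half_edge_sibling[of i i'] ne i' True by auto
      then show ?thesis using assms by simp
    next
      case False
      then have "i' \<noteq> i" "D (i' div 2) = origin i'" using i' by auto
      then show ?thesis using l i' ne(5)[OF i'(1)] unfolding labelled_def by auto
    qed
    show "H (origin i') \<le> Suc (H (target i'))" using * by blast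
    show "H (origin i') \<le> H (target i')" if "(C(x := p)) (origin i') \<le> i'" using * that by blast
  next
    fix u assume "u < n" "0 < H u"
    then have "k \<le> G u" using l unfolding labelled_def by blast
    then show "k \<le> (G(x := G x - 1, target i := Suc (G (target i)))) u" using assms by auto
  qed
qed

lemma oriented_push:
  assumes i: "i < 2 * m" "origin i = x" and o: "oriented D G" and D: "D (i div 2) = x"
  shows "oriented (D(i div 2 := target i)) (G(x := G x - 1, target i := Suc (G (target i))))"
proof -
  let ?D = "D(i div 2 := target i)" and ?j = "i div 2"
  have j: "?j < m" using i by (rule_tac half_edge_div)
  have t: "target i \<noteq> x" "x < n" "target i < n"
    using origin_neq_target origin_less target_less i by metis+
  have "{j. j < m \<and> ?D j = x} = {j. j < m \<and> D j = x} - {?j}" using t by auto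
  then have x: "card {j. j < m \<and> ?D j = x} = card {j. j < m \<and> D j = x} - 1" using j D by simp
  have "{j. j < m \<and> ?D j = target i} = insert ?j {j. j < m \<and> D j = target i}" using j by auto
  then have y: "card {j. j < m \<and> ?D j = target i} = Suc (card {j. j < m \<and> D j = target i})"
    using t D by simp
  have z: "{j. j < m \<and> ?D j = u} = {j. j < m \<and> D j = u}" if "u \<noteq> x" "u \<noteq> target i" for u
    using that D by auto
  show ?thesis using o x y z t ends_half_edge[of i] unfolding oriented_def by auto
qed

text \<open>A null pointer at \<open>x\<close> means that all half-edges there have been passed, so
  no out-edge has a dropping label and raising \<open>H x\<close> by one creates drops of at most
  one. Resetting the pointer to the list head withdraws all claims about passed half-edges. The
  potential gains at most the degree of \<open>x\<close> and loses the degree plus one.\<close>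

lemma labelled_relabel:
  assumes "pointers C" "x < n" "C x = 0" and p: "last_half_edge (2 * m) x p"
    and l: "labelled k D C G H" and "k < G x"
  shows "labelled k D (C(x := p)) G (H(x := Suc (H x)))" "pointers (C(x := p))"
    "H x < L \<Longrightarrow> potential L (C(x := p)) (H(x := Suc (H x))) < potential L C H"
proof -
  show "pointers (C(x := p))" using assms unfolding pointers_def last_half_edge_def by auto
  show "labelled k D (C(x := p)) G (H(x := Suc (H x)))"
    unfolding labelled_def
  proof (intro conjI allI impI)
    fix i assume i: "i < 2 * m" "D (i div 2) = origin i"
    have *: "H (origin i) \<le> Suc (H (target i))" "C (origin i) \<le> i \<Longrightarrow> H (origin i) \<le> H (target i)"
      using l i unfolding labelled_def by blast+
    have "target i \<noteq> origin i" using origin_neq_target[OF i(1)] by simp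
    then show "(H(x := Suc (H x))) (origin i) \<le> Suc ((H(x := Suc (H x))) (target i))"
      using * assms(3) by auto
    have "i < p" if "origin i = x" using p i(1) that unfolding last_half_edge_def by blast
    then show "(H(x := Suc (H x))) (origin i) \<le> (H(x := Suc (H x))) (target i)"
      if "(C(x := p)) (origin i) \<le> i" using * that by (auto simp: le_Suc_eq)
  next
    fix u assume "u < n" "0 < (H(x := Suc (H x))) u"
    then show "k \<le> G u" using l assms(6) unfolding labelled_def by (auto split: if_splits)
  qed
  assume L: "H x < L"
  have p': "card {i. i < p \<and> origin i = x} \<le> card {i. i < 2 * m \<and> origin i = x}"
    using p unfolding last_half_edge_def by (intro card_mono) auto
  define e where "e = L - Suc (H x)"
  then have e: "L - H x = Suc e" "L - Suc (H x) = e" using L by linarith+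
  show "potential L (C(x := p)) (H(x := Suc (H x))) < potential L C H"
    unfolding potential_def using p' by (intro sum_upd_less[OF assms(2)]) (simp_all add: e)
qed

text \<open>Lets a new test start from the orientation and the pointers that the previous test has
  left.\<close>

lemma labelled_zero: "(\<And>u. u < n \<Longrightarrow> H u = 0) \<Longrightarrow> labelled k D C G H"
  using origin_less unfolding labelled_def by simp

text \<open>The degrees sum to at most \<open>2 * m\<close>, and \<open>n \<le> m\<close>.\<close>

lemma potential_le:
  assumes "pointers C"
  shows "potential L C H \<le> (L + 1) * (3 * m)"
proof -
  let ?c = "\<lambda>u. card {i. i < 2 * m \<and> origin i = u}"
  have "potential L C H \<le> (\<Sum>u<n. L * Suc (?c u) + ?c u)"
    unfolding potential_def
  proof (intro sum_mono add_mono mult_le_mono)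
    fix u assume "u \<in> {..<n}"
    then show "card {i. i < C u \<and> origin i = u} \<le> ?c u"
      using assms unfolding pointers_def by (intro card_mono) auto
  qed auto
  also have "\<dots> = L * (n + (\<Sum>u<n. ?c u)) + (\<Sum>u<n. ?c u)"
    by (simp add: sum.distrib sum_distrib_left algebra_simps)
  also have "(\<Sum>u<n. ?c u) = card {i. i < 2 * m \<and> origin i < n}"
    using card_fibres[of "{..<2 * m}" "{..<n}" origin] by simp
  finally have "potential L C H \<le>
      L * (n + card {i. i < 2 * m \<and> origin i < n}) + card {i. i < 2 * m \<and> origin i < n}" .
  also have "\<dots> \<le> L * (n + 2 * m) + 2 * m"
  proof -
    have "card {i. i < 2 * m \<and> origin i < n} \<le> card {..<2 * m}" by (rule card_mono) auto
    then show ?thesis by (intro add_mono mult_le_mono2) simp_all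
  qed
  also have "\<dots> \<le> L * (3 * m) + 3 * m"
    using m_ge by (intro add_mono mult_le_mono2) simp_all
  finally show ?thesis by (simp add: algebra_simps)
qed

text \<open>A label that reaches \<open>L\<close> certifies that \<open>k\<close> is too small:
  otherwise each level set \<open>S (Suc i)\<close> is smaller than \<open>S i\<close> by a factor
  \<open>q\<close>, and \<open>S L\<close> would be empty.\<close>

lemma label_bound:
  assumes o: "oriented D G" and l: "labelled k D C G H"
    and u: "u < n" "L \<le> H u" and q: "1 \<le> q" "real n < q ^ L"
  shows "real k < q * dens"
proof (rule ccontr)
  assume "\<not> real k < q * dens"
  then have k: "q * dens \<le> real k" by simp
  define S where "S i = {u. u < n \<and> i \<le> H u}" for i
  have fS: "finite (S i)" for i unfolding S_def by simp
  have step: "q * real (card (S (Suc i))) \<le> real (card (S i))" for i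
  proof -
    have "k * card (S (Suc i)) \<le> (\<Sum>u\<in>S (Suc i). G u)"
      using sum_bounded_below[of "S (Suc i)" k G] l unfolding labelled_def S_def by (auto simp: mult.commute)
    also have "\<dots> = (\<Sum>u\<in>S (Suc i). card {j. j < m \<and> D j = u})"
      using o unfolding oriented_def S_def by (intro sum.cong) auto
    also have "\<dots> = card {j. j < m \<and> D j \<in> S (Suc i)}"
      using card_fibres[of "{..<m}" "S (Suc i)" D] fS by simp
    also have "\<dots> \<le> card (inside (S i))"
    proof (rule card_mono)
      \<comment> \<open>Labels drop by at most one from the tail, so the other end is still in
        \<open>S i\<close>.\<close>
      show "{j. j < m \<and> D j \<in> S (Suc i)} \<subseteq> inside (S i)"
      proof clarify
        fix j assume j: "j < m" "D j \<in> S (Suc i)"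
        obtain h where h: "h < 2 * m" "h div 2 = j" "origin h = D j"
          using half_edge_of_end[OF j(1)] o j unfolding oriented_def by metis
        then have "H (origin h) \<le> Suc (H (target h))" using l unfolding labelled_def by metis
        then have "{origin h, target h} \<subseteq> S i"
          using j h target_less[OF h(1)] origin_less[OF h(1)] unfolding S_def by auto
        then show "j \<in> inside (S i)" using ends_half_edge[of h] h j unfolding inside_def by simp
      qed
    qed simp
    finally have "real (k * card (S (Suc i))) \<le> real (card (inside (S i)))" by (simp only: of_nat_le_iff)
    also have "\<dots> \<le> dens * real (card (S i))" by (rule card_inside_le) (auto simp: S_def)
    finally have "q * dens * real (card (S (Suc i))) \<le> dens * real (card (S i))"
      using k by (metis (no_types, lifting) mult_right_mono of_nat_0_le_iff of_nat_mult order_trans)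
    then have "dens * (q * real (card (S (Suc i)))) \<le> dens * real (card (S i))" by (simp add: mult_ac)
    then show ?thesis using one_le_dens by (simp add: mult_le_cancel_left)
  qed
  have "q ^ i * real (card (S i)) \<le> real n" for i
  proof (induction i)
    case 0
    have "card (S 0) \<le> card {..<n}" by (rule card_mono) (auto simp: S_def)
    then show ?case by simp
  next
    case (Suc i)
    have "q ^ Suc i * real (card (S (Suc i))) = q ^ i * (q * real (card (S (Suc i))))" by simp
    also have "\<dots> \<le> q ^ i * real (card (S i))" using step q by (intro mult_left_mono) auto
    finally show ?case using Suc by linarith
  qed
  from this[of L] have "q ^ L * real (card (S L)) \<le> real n" .
  moreover have "card (S L) \<ge> 1" using u fS unfolding S_def by (metis (mono_tags, lifting) One_nat_def Suc_leI card_gt_0_iff empty_iff mem_Collect_eq)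
  then have "q ^ L * 1 \<le> q ^ L * real (card (S L))" using q by (intro mult_left_mono) auto
  ultimately show False using q by simp
qed

lemma oriented_le:
  assumes "oriented D G" "u < n" shows "G u \<le> m"
proof -
  have "card {j. j < m \<and> D j = u} \<le> card {..<m}" by (rule card_mono) auto
  then show ?thesis using assms by (simp add: oriented_def)
qed

end

section \<open>The program\<close>

notation Seq (infixr \<open>;;\<close> 60)

text \<open>
  Register 2 holds the lower bound \<open>\<rho>\<close> for the density, registers 3 and 4 the numbers of vertices and
  edges that have not been peeled off. Registers 10, 12 and 13 hold the cap on the labels, the
  tested out-degree bound \<open>k\<close> and its increment; register 14 is 0 until a test has succeeded.
  Registers 5 to 9 and 11 are temporary.

  Arrays indexed by vertices: 3 (peeled off), 4 (degree among the unpeeled vertices), 6 (first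
  half-edge), 7 (current half-edge), 8 (label), 9 (out-degree), 11 (number of out-edges already
  assigned to a class). Array 5 links the half-edges at a vertex, array 10 holds the tails of the
  edges. Links to half-edges are shifted by one, so that 0 is the null pointer.
\<close>

definition peel_count :: com where
  "peel_count = For 5 (Reg 1)
    (Load 6 0 (Reg 5) ;; Load 7 1 (Reg 5) ;; Load 8 3 (Reg 6) ;; Load 9 3 (Reg 7) ;;
     Arith 8 Add (Reg 8) (Reg 9) ;;
     If Eq (Reg 8) (Imm 0)
       (Load 8 4 (Reg 6) ;; Arith 8 Add (Reg 8) (Imm 1) ;; Store 4 (Reg 6) (Reg 8) ;;
        Load 8 4 (Reg 7) ;; Arith 8 Add (Reg 8) (Imm 1) ;; Store 4 (Reg 7) (Reg 8) ;;
        Arith 4 Add (Reg 4) (Imm 1))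
       Skip)"

text \<open>Register 7 holds the degree threshold. The same pass resets the degrees for the count of
  the next round.\<close>

definition peel_remove :: com where
  "peel_remove = For 5 (Reg 0)
    (Load 6 3 (Reg 5) ;;
     If Eq (Reg 6) (Imm 0)
       (Load 6 4 (Reg 5) ;;
        If Lt (Reg 6) (Reg 7) (Store 3 (Reg 5) (Imm 1) ;; Arith 3 Sub (Reg 3) (Imm 1)) Skip)
       Skip ;;
     Store 4 (Reg 5) (Imm 0))"

text \<open>Subtraction is truncated, so subtracting register 2 and adding it back updates it to a
  maximum.\<close>

definition peel_round :: com where
  "peel_round =
     Move 4 (Imm 0) ;; peel_count ;;
     Arith 6 Div (Reg 4) (Reg 3) ;; Arith 6 Sub (Reg 6) (Reg 2) ;; Arith 2 Add (Reg 2) (Reg 6) ;;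
     Arith 7 Mul (Reg 2) (Imm 4) ;; Arith 7 Add (Reg 7) (Imm 4) ;;
     peel_remove"

definition peel :: com where
  "peel = Move 3 (Reg 0) ;; While Lt (Imm 0) (Reg 3) peel_round"

section \<open>Correctness and running time of peeling\<close>

text \<open>The precision is \<open>1 / b\<close>. The word size leaves room for numbers up to
  \<open>8 * m + 8\<close> and for labels up to \<open>b * (m + 1)\<close>.\<close>

locale ram_input = edge_list +
  fixes w b :: nat
  assumes b_pos: "1 \<le> b" and word_size: "(b + 8) * (m + 1) < 2 ^ w"
begin

lemma fits: "x \<le> 8 * m + 8 \<Longrightarrow> x < 2 ^ w"
  using word_size by (simp add: algebra_simps)

lemma fits_label: "x \<le> b * (m + 1) \<Longrightarrow> x < 2 ^ w"
  using word_size by (simp add: algebra_simps)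

lemma two_le_m: "2 \<le> m" using n_ge m_ge by linarith

definition graph :: "state \<Rightarrow> bool" where
  "graph s \<longleftrightarrow> reg s 0 = n \<and> reg s 1 = m \<and>
     (\<forall>j<m. arr s 0 j = fst (es ! j)) \<and> (\<forall>j<m. arr s 1 j = snd (es ! j))"

text \<open>The zeros from which later phases start; peeling and the computation of the cap leave
  them untouched.\<close>

definition clean :: "state \<Rightarrow> bool" where
  "clean s \<longleftrightarrow> arr s 6 = (\<lambda>_. 0) \<and> arr s 7 = (\<lambda>_. 0) \<and> arr s 9 = (\<lambda>_. 0) \<and> arr s 11 = (\<lambda>_. 0)"

definition alive :: "(nat \<Rightarrow> nat) \<Rightarrow> nat set" where
  "alive g = {v. v < n \<and> g v = 0}"

lemma finite_alive [simp]: "finite (alive g)" by (simp add: alive_def)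

text \<open>Both flags vanish iff their sum does, so the program gets by with a single test per
  edge.\<close>

lemma inside_alive: "i < m \<Longrightarrow> i \<in> inside (alive g) \<longleftrightarrow> g (fst (es ! i)) + g (snd (es ! i)) = 0"
  using ends_less[of i] by (auto simp: inside_def alive_def ends_def)

lemma card_less_le: "card {i. i < N \<and> P i} \<le> (N :: nat)"
  using card_mono[of "{..<N}" "{i. i < N \<and> P i}"] by auto

lemma run_peel_count:
  assumes "graph s" "clean s" "reg s 2 = r" "reg s 3 = c" "arr s 3 = g" "reg s 4 = 0"
    and "\<forall>v<n. arr s 4 v = 0" and g: "\<forall>v<n. g v \<le> 1"
  shows "run w peel_count s (\<lambda>t s'. t \<le> 16 * m + 2 \<and> graph s' \<and> clean s' \<and> reg s' 2 = r \<and>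
    reg s' 3 = c \<and> arr s' 3 = g \<and> reg s' 4 = card (inside (alive g)) \<and>
    (\<forall>v<n. arr s' 4 v = inner_degree (alive g) v))"
proof -
  let ?U = "inside (alive g)"
  let ?I = "\<lambda>i s. graph s \<and> clean s \<and> reg s 2 = r \<and> reg s 3 = c \<and> arr s 3 = g \<and>
    reg s 4 = card {j. j < i \<and> j \<in> ?U} \<and>
    (\<forall>v<n. arr s 4 v = card {h. h < 2 * i \<and> (h div 2 \<in> ?U \<and> origin h = v)})"
  show ?thesis unfolding peel_count_def
  proof (rule run_For[where I = ?I and N = m and B = 14])
    show "m < 2 ^ w" by (rule fits) simp
  next
    fix i s assume I: "?I i s" and i: "i < m" "reg s 5 = i"
    have small: "card {j. j < i \<and> P j} + 1 < 2 ^ w"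
        "card {h. h < 2 * i \<and> P h} + 1 < 2 ^ w" "i < 2 ^ w" for P
      using card_less_le[of i P] card_less_le[of "2 * i" P] i by (auto intro!: fits)
    have e: "fst (es ! i) < n" "snd (es ! i) < n" "fst (es ! i) \<noteq> snd (es ! i)"
      using ends_less[OF i(1)] ends_neq[OF i(1)] by auto
    then have e': "fst (es ! i) < 2 ^ w" "snd (es ! i) < 2 ^ w" using m_ge by (auto intro!: fits)
    have g': "g (fst (es ! i)) + g (snd (es ! i)) < 2 ^ w"
    proof (rule fits)
      have "g (fst (es ! i)) \<le> 1" "g (snd (es ! i)) \<le> 1" using g e by blast+
      then show "g (fst (es ! i)) + g (snd (es ! i)) \<le> 8 * m + 8" by linarith
    qed
    show "run w (Load 6 0 (Reg 5) ;; Load 7 1 (Reg 5) ;; Load 8 3 (Reg 6) ;; Load 9 3 (Reg 7) ;;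
     Arith 8 Add (Reg 8) (Reg 9) ;;
     If Eq (Reg 8) (Imm 0)
       (Load 8 4 (Reg 6) ;; Arith 8 Add (Reg 8) (Imm 1) ;; Store 4 (Reg 6) (Reg 8) ;;
        Load 8 4 (Reg 7) ;; Arith 8 Add (Reg 8) (Imm 1) ;; Store 4 (Reg 7) (Reg 8) ;;
        Arith 4 Add (Reg 4) (Imm 1))
       Skip) s (\<lambda>t s'. t \<le> 14 \<and> reg s' 5 = i \<and> ?I (Suc i) (s'\<lparr>reg := (reg s')(5 := Suc i)\<rparr>))"
      using I i small e e' g' inside_alive[OF i(1), of g]
      by (auto simp: graph_def clean_def card_less_Suc_if)
  next
    fix t s' assume "?I m s'" "t \<le> (14 + 2) * m + 2"
    moreover have "{j. j < m \<and> j \<in> ?U} = ?U" by (auto simp: inside_def)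
    ultimately show "t \<le> 16 * m + 2 \<and> graph s' \<and> clean s' \<and> reg s' 2 = r \<and>
      reg s' 3 = c \<and> arr s' 3 = g \<and> reg s' 4 = card (inside (alive g)) \<and>
      (\<forall>v<n. arr s' 4 v = inner_degree (alive g) v)" by (simp add: inner_degree_def)
  qed (use assms in \<open>auto simp: graph_def clean_def\<close>)
qed

lemma run_peel_remove:
  assumes "graph s" "clean s" "reg s 2 = r" "reg s 7 = T" "arr s 3 = g" "reg s 3 = card (alive g)"
    and "\<forall>v<n. arr s 4 v = dg v" and g: "\<forall>v<n. g v \<le> 1"
  shows "run w peel_remove s (\<lambda>t s'. t \<le> 10 * n + 2 \<and> graph s' \<and> clean s' \<and> reg s' 2 = r \<and>
    alive (arr s' 3) = {v \<in> alive g. T \<le> dg v} \<and> (\<forall>v<n. arr s' 3 v \<le> 1) \<and>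
    reg s' 3 = card (alive (arr s' 3)) \<and> (\<forall>v<n. arr s' 4 v = 0))"
proof -
  let ?I = "\<lambda>i s. graph s \<and> clean s \<and> reg s 2 = r \<and> reg s 7 = T \<and>
    (\<forall>v<n. arr s 3 v = (if v < i \<and> g v = 0 \<and> dg v < T then 1 else g v)) \<and>
    (\<forall>v<n. arr s 4 v = (if v < i then 0 else dg v)) \<and> reg s 3 = card (alive (arr s 3))"
  show ?thesis unfolding peel_remove_def
  proof (rule run_For[where I = ?I and N = n and B = 8])
    show "n < 2 ^ w" using m_ge by (intro fits) simp
  next
    fix i s assume I: "?I i s" and i: "i < n" "reg s 5 = i"
    have "card (alive (arr s 3)) \<le> n" unfolding alive_def by (rule card_less_le)
    then have small: "i < 2 ^ w" "(1::nat) < 2 ^ w" "reg s 3 - 1 < 2 ^ w" using I i m_ge by (auto intro!: fits)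
    have c: "card (alive ((arr s 3)(i := Suc 0))) = reg s 3 - 1" if "g i = 0"
    proof -
      have "alive ((arr s 3)(i := Suc 0)) = alive (arr s 3) - {i}" by (auto simp: alive_def)
      moreover have "i \<in> alive (arr s 3)" using I i that by (simp add: alive_def)
      ultimately show ?thesis using I by simp
    qed
    show "run w (Load 6 3 (Reg 5) ;;
     If Eq (Reg 6) (Imm 0)
       (Load 6 4 (Reg 5) ;;
        If Lt (Reg 6) (Reg 7) (Store 3 (Reg 5) (Imm 1) ;; Arith 3 Sub (Reg 3) (Imm 1)) Skip)
       Skip ;;
     Store 4 (Reg 5) (Imm 0)) s (\<lambda>t s'. t \<le> 8 \<and> reg s' 5 = i \<and> ?I (Suc i) (s'\<lparr>reg := (reg s')(5 := Suc i)\<rparr>))"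
      using I i small c by (auto simp: graph_def clean_def less_Suc_eq)
  next
    fix t s' assume "?I n s'" "t \<le> (8 + 2) * n + 2"
    then show "t \<le> 10 * n + 2 \<and> graph s' \<and> clean s' \<and> reg s' 2 = r \<and>
      alive (arr s' 3) = {v \<in> alive g. T \<le> dg v} \<and> (\<forall>v<n. arr s' 3 v \<le> 1) \<and>
      reg s' 3 = card (alive (arr s' 3)) \<and> (\<forall>v<n. arr s' 4 v = 0)"
      using g by (auto simp: alive_def split: if_splits)
  qed (use assms in \<open>auto simp: graph_def clean_def\<close>)
qed

text \<open>The last conjunct makes the first round see the whole graph, whose density is at least
  1; so every round ends with a positive estimate in register 2.\<close>

definition peel_inv :: "state \<Rightarrow> bool" where
  "peel_inv s \<longleftrightarrow> graph s \<and> clean s \<and> (\<forall>v<n. arr s 3 v \<le> 1) \<and> (\<forall>v<n. arr s 4 v = 0) \<and>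
     reg s 3 = card (alive (arr s 3)) \<and> charged (alive (arr s 3)) (4 * reg s 2 + 4) \<and>
     real (reg s 2) \<le> dens \<and> (reg s 2 = 0 \<longrightarrow> alive (arr s 3) = {0..<n})"

lemma card_inside_div_le: "real (card (inside (alive g)) div card (alive g)) \<le> dens"
proof (cases "alive g = {}")
  case True then show ?thesis using one_le_dens by simp
next
  case False
  have "real (card (inside (alive g)) div card (alive g)) \<le> card (inside (alive g)) / card (alive g)"
    by (simp add: of_nat_div_le_of_nat)
  also have "card (inside (alive g)) \<le> dens * card (alive g)"
    by (rule card_inside_le) (auto simp: alive_def)
  then have "card (inside (alive g)) / card (alive g) \<le> dens"
    using False by (simp add: field_simps card_gt_0_iff)
  finally show ?thesis .
qed

lemma run_peel_round:
  assumes I: "peel_inv s" and pos: "0 < reg s 3"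
  shows "run w peel_round s (\<lambda>t s'. t \<le> 39 * m \<and> peel_inv s' \<and> 2 * reg s' 3 < reg s 3)"
proof -
  define g where "g = arr s 3"
  define U where "U = alive g"
  define q where "q = card (inside U) div card U"
  define r where "r = max (reg s 2) q"
  have U: "finite U" "U \<noteq> {}" "card U = reg s 3" using I pos unfolding peel_inv_def U_def g_def by auto
  have qd: "real q \<le> dens" unfolding q_def U_def by (rule card_inside_div_le)
  have rd: "real r \<le> dens" using qd I unfolding r_def peel_inv_def by (simp add: max_def)
  then have rm: "r \<le> m" using dens_le_m by linarith
  have qm: "q \<le> m" using rm unfolding r_def by simp
  have r0: "r \<noteq> 0"
  proof
    assume "r = 0"
    then have "U = {0..<n}" "q = 0" using I unfolding r_def peel_inv_def U_def g_def by auto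
    then show False using m_ge n_ge unfolding q_def by (auto simp: inside_all div_eq_0_iff)
  qed
  have peel: "2 * card {v \<in> U. 4 * r + 4 \<le> inner_degree U v} < card U"
    using U by (intro peel_halves) (auto simp: r_def q_def)
  have chg: "charged {v \<in> U. 4 * r + 4 \<le> inner_degree U v} (4 * r + 4)"
  proof (rule charged_peel)
    have "charged U (4 * reg s 2 + 4)" using I by (simp add: peel_inv_def U_def g_def)
    then show "charged U (4 * r + 4)" by (rule charged_mono) (simp add: r_def)
  qed (use U in auto)
  have r: "reg s 2 + (q - reg s 2) = r" unfolding r_def by simp
  then have r4: "reg s 2 * 4 + (q - reg s 2) * 4 = r * 4" by (metis add_mult_distrib)
  let ?s = "s\<lparr>reg := (reg s)(4 := operand_val (Imm 0) s)\<rparr>"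
  have pc: "run w peel_count ?s (\<lambda>t s'. t \<le> 16 * m + 2 \<and> graph s' \<and> clean s' \<and> reg s' 2 = reg s 2 \<and>
    reg s' 3 = card U \<and> arr s' 3 = g \<and> reg s' 4 = card (inside (alive g)) \<and>
    (\<forall>v<n. arr s' 4 v = inner_degree (alive g) v))"
    by (rule run_peel_count) (use I U in \<open>simp_all add: peel_inv_def graph_def clean_def g_def\<close>)
  show ?thesis unfolding peel_round_def run_Seq run_Move
  proof (intro conjI, goal_cases)
    case 2
    show ?case
    proof (rule run_mono[OF pc], elim conjE, goal_cases)
      case (1 t1 s1)
      let ?s1 = "s1\<lparr>reg := (reg s1)(6 := q - reg s 2, 2 := r, 7 := r * 4 + 4)\<rparr>"
      have "run w peel_remove ?s1 (\<lambda>t s'. t \<le> 10 * n + 2 \<and> graph s' \<and> clean s' \<and> reg s' 2 = r \<and>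
        alive (arr s' 3) = {v \<in> alive g. 4 * r + 4 \<le> inner_degree (alive g) v} \<and> (\<forall>v<n. arr s' 3 v \<le> 1) \<and>
        reg s' 3 = card (alive (arr s' 3)) \<and> (\<forall>v<n. arr s' 4 v = 0))"
        by (rule run_peel_remove) (use 1 I U in \<open>simp_all add: peel_inv_def graph_def clean_def g_def U_def\<close>)
      then have "run w peel_remove ?s1 (\<lambda>t s'. t \<le> 10 * n + 2 \<and> peel_inv s' \<and> 2 * reg s' 3 < reg s 3)"
        by (rule run_mono) (use r0 rd chg peel U in \<open>auto simp: peel_inv_def U_def\<close>)
      then show ?case
        using 1 two_le_m m_ge rm qm
        by (auto simp: r r4 q_def[symmetric] U_def[symmetric] intro!: fits elim!: run_mono)
    qed
  qed (auto intro: fits)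
qed

text \<open>\<open>floorlog 2 x\<close> is the number of binary digits of \<open>x\<close>, which
  drops in every round of peeling.\<close>

lemma floorlog_half:
  assumes "2 * x' < x"
  shows "Suc (floorlog 2 x') \<le> floorlog 2 x"
proof (cases "x' = 0")
  case True
  then show ?thesis using assms floorlog_ge_SucI[of 2 0 x] by (simp add: floorlog_def)
next
  case False
  have "2 ^ (floorlog 2 x' - 1) \<le> x'" using False floorlog_bounds[of x' 2] by simp
  moreover have "0 < floorlog 2 x'" using False by (simp add: floorlog_def)
  ultimately have "2 ^ floorlog 2 x' \<le> x" using assms by (cases "floorlog 2 x'") auto
  then show ?thesis by (intro floorlog_ge_SucI) auto
qed

text \<open>The loop is paid for with \<open>40 * m\<close> units per binary digit of the number of
  remaining vertices. In the end \<open>charged_empty\<close> bounds the density by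
  \<open>4 * \<rho> + 4\<close>, which is at most \<open>8 * \<rho>\<close> as
  \<open>\<rho> \<ge> 1\<close>.\<close>

lemma run_peel:
  assumes "graph s" "clean s" "reg s 2 = 0" "arr s 3 = (\<lambda>_. 0)" "arr s 4 = (\<lambda>_. 0)"
  shows "run w peel s (\<lambda>t s'. t \<le> 40 * m * floorlog 2 n + 2 \<and> graph s' \<and> clean s' \<and>
    1 \<le> reg s' 2 \<and> real (reg s' 2) \<le> dens \<and> dens \<le> 8 * real (reg s' 2))"
proof -
  let ?s = "s\<lparr>reg := (reg s)(3 := operand_val (Reg 0) s)\<rparr>"
  let ?f = "\<lambda>s. 40 * m * floorlog 2 (reg s 3)"
  have all: "alive (\<lambda>_. 0) = {0..<n}" by (auto simp: alive_def)
  show ?thesis unfolding peel_def run_Seq run_Move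
  proof (rule conjI[OF _ run_While[where I = peel_inv and f = ?f]])
    show "operand_val (Reg 0) s < 2 ^ w" using assms(1) m_ge by (auto simp: graph_def intro: fits)
    show "peel_inv ?s"
      using assms one_le_dens all charged_all by (simp add: peel_inv_def graph_def clean_def)
  next
    fix s assume "peel_inv s" "comparison_val Lt (operand_val (Imm 0) s) (operand_val (Reg 3) s)"
    then have "run w peel_round s (\<lambda>t s'. t \<le> 39 * m \<and> peel_inv s' \<and> 2 * reg s' 3 < reg s 3)"
      by (intro run_peel_round) auto
    then show "run w peel_round s (\<lambda>t s'. peel_inv s' \<and> 1 + t + ?f s' \<le> ?f s)"
    proof (rule run_mono, elim conjE, intro conjI)
      fix t s' assume t: "t \<le> 39 * m" "2 * reg s' 3 < reg s 3"
      have "40 * m * Suc (floorlog 2 (reg s' 3)) \<le> ?f s"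
        using floorlog_half[OF t(2)] by (intro mult_le_mono2)
      then show "1 + t + ?f s' \<le> ?f s" using t(1) two_le_m by simp
    qed
  next
    fix t s' assume I: "peel_inv s'" and "\<not> comparison_val Lt (operand_val (Imm 0) s') (operand_val (Reg 3) s')"
      and t: "t + ?f s' \<le> 1 + ?f ?s"
    then have e: "alive (arr s' 3) = {}" by (simp add: peel_inv_def)
    then have r: "1 \<le> reg s' 2" using I n_ge by (cases "reg s' 2") (auto simp: peel_inv_def)
    have "dens \<le> real (4 * reg s' 2 + 4)" using I e by (intro charged_empty) (simp add: peel_inv_def)
    then have "dens \<le> 8 * real (reg s' 2)" using r by simp
    then show "1 + t \<le> 40 * m * floorlog 2 n + 2 \<and> graph s' \<and> clean s' \<and>
      1 \<le> reg s' 2 \<and> real (reg s' 2) \<le> dens \<and> dens \<le> 8 * real (reg s' 2)"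
      using I r t assms(1) by (simp add: peel_inv_def graph_def)
  qed
qed

end

section \<open>Programs for the label cap, the adjacency lists and push-relabel\<close>

text \<open>\<open>b\<close> is added once for every power of two that is at most \<open>n\<close>,
  hence \<open>floorlog 2 n\<close> times.\<close>

definition label_cap :: "nat \<Rightarrow> com" where
  "label_cap b = Move 11 (Imm 1) ;; Move 10 (Imm 0) ;;
     While Le (Reg 11) (Reg 0) (Arith 11 Mul (Reg 11) (Imm 2) ;; Arith 10 Add (Reg 10) (Imm b))"

text \<open>Register 8 holds the number of the half-edge. Incrementing it yields the shifted link
  and at the same time the number of the next half-edge.\<close>

definition insert_half_edge :: "nat \<Rightarrow> com" where
  "insert_half_edge r = Load 9 6 (Reg r) ;; Store 5 (Reg 8) (Reg 9) ;;
     Arith 8 Add (Reg 8) (Imm 1) ;; Store 6 (Reg r) (Reg 8)"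

definition insert_edge :: com where
  "insert_edge = insert_half_edge 6 ;; insert_half_edge 7"

text \<open>Initially every edge is directed away from its first listed end.\<close>

definition build :: com where
  "build = For 5 (Reg 1)
    (Load 6 0 (Reg 5) ;; Load 7 1 (Reg 5) ;; Store 10 (Reg 5) (Reg 6) ;;
     Load 8 9 (Reg 6) ;; Arith 8 Add (Reg 8) (Imm 1) ;; Store 9 (Reg 6) (Reg 8) ;;
     Arith 8 Mul (Imm 2) (Reg 5) ;; insert_edge)"

text \<open>At the cap the test has failed; setting register 15 to \<open>n\<close> ends the routing
  loop.\<close>

definition relabel_step :: com where
  "relabel_step =
     Load 7 6 (Reg 16) ;; Store 7 (Reg 16) (Reg 7) ;;
     Load 7 8 (Reg 16) ;; Arith 7 Add (Reg 7) (Imm 1) ;; Store 8 (Reg 16) (Reg 7) ;;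
     If Eq (Reg 7) (Reg 10) (Move 14 (Imm 0) ;; Move 15 (Reg 0)) Skip"

text \<open>On entry registers 6, 7 and 8 hold the out-degree of \<open>x\<close>, the edge and its
  other end. Routing continues at that other end.\<close>

definition push_step :: com where
  "push_step =
     Store 10 (Reg 7) (Reg 8) ;;
     Arith 6 Sub (Reg 6) (Imm 1) ;; Store 9 (Reg 16) (Reg 6) ;;
     Load 6 9 (Reg 8) ;; Arith 6 Add (Reg 6) (Imm 1) ;; Store 9 (Reg 8) (Reg 6) ;;
     Move 16 (Reg 8)"

text \<open>The other end of the edge is obtained as the sum of both ends minus
  \<open>x\<close>.\<close>

definition scan_step :: com where
  "scan_step =
     Arith 7 Sub (Reg 7) (Imm 1) ;; Load 8 5 (Reg 7) ;; Store 7 (Reg 16) (Reg 8) ;;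
     Arith 7 Div (Reg 7) (Imm 2) ;; Load 8 10 (Reg 7) ;;
     If Eq (Reg 8) (Reg 16)
       (Load 8 0 (Reg 7) ;; Load 9 1 (Reg 7) ;; Arith 8 Add (Reg 8) (Reg 9) ;;
        Arith 8 Sub (Reg 8) (Reg 16) ;; Load 9 8 (Reg 8) ;; Load 11 8 (Reg 16) ;;
        If Lt (Reg 9) (Reg 11) push_step Skip)
       Skip"

text \<open>Without excess at \<open>x\<close>, routing returns to \<open>v\<close>, or moves on to
  the next vertex if it is already there.\<close>

definition walk_step :: com where
  "walk_step =
     Load 6 9 (Reg 16) ;;
     If Lt (Reg 12) (Reg 6)
       (Load 7 7 (Reg 16) ;; If Eq (Reg 7) (Imm 0) relabel_step scan_step)
       (If Eq (Reg 16) (Reg 15)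
         (Arith 15 Add (Reg 15) (Imm 1) ;; Move 16 (Reg 15)) (Move 16 (Reg 15)))"

section \<open>The cap, the adjacency lists and a single routing step\<close>

context ram_input
begin

definition cap :: nat where "cap = b * floorlog 2 n"

lemma floorlog_n: "0 < floorlog 2 n" "floorlog 2 n \<le> n" "n < 2 ^ floorlog 2 n"
proof -
  show "0 < floorlog 2 n" using n_ge floorlog_ge_SucI[of 2 0 n] by simp
  show "floorlog 2 n \<le> n" by (rule floorlog_leI) auto
  show "n < 2 ^ floorlog 2 n" using n_ge floorlog_bounds[of n 2] by simp
qed

lemma cap_fits: "x \<le> cap \<Longrightarrow> x < 2 ^ w"
proof (rule fits_label)
  have "cap \<le> b * (m + 1)" unfolding cap_def using floorlog_n(2) m_ge by (intro mult_le_mono2) linarith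
  then show "x \<le> cap \<Longrightarrow> x \<le> b * (m + 1)" by linarith
qed

lemma cap_pos: "0 < cap" using floorlog_n b_pos by (simp add: cap_def)

lemma run_label_cap:
  assumes "graph s" "clean s" "reg s 2 = r"
  shows "run w (label_cap b) s (\<lambda>t s'. t \<le> 3 * floorlog 2 n + 3 \<and> graph s' \<and> clean s' \<and>
    reg s' 2 = r \<and> reg s' 10 = cap)"
proof -
  let ?I = "\<lambda>s. graph s \<and> clean s \<and> reg s 2 = r \<and>
    (\<exists>i. i \<le> floorlog 2 n \<and> reg s 11 = 2 ^ i \<and> reg s 10 = b * i)"
  \<comment> \<open>The quotient \<open>reg s 10 div b\<close> recovers the number of completed
    passes.\<close>
  let ?f = "\<lambda>s. 3 * (floorlog 2 n - reg s 10 div b)"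
  let ?s = "s\<lparr>reg := (reg s)(11 := 1, 10 := 0)\<rparr>"
  have "run w (While Le (Reg 11) (Reg 0) (Arith 11 Mul (Reg 11) (Imm 2) ;; Arith 10 Add (Reg 10) (Imm b)))
    ?s (\<lambda>t s'. t \<le> 3 * floorlog 2 n + 1 \<and> graph s' \<and> clean s' \<and> reg s' 2 = r \<and> reg s' 10 = cap)"
  proof (rule run_While[where I = ?I and f = ?f])
    show "?I ?s" using assms by (auto simp: graph_def clean_def)
  next
    fix s assume I: "?I s" and c: "comparison_val Le (operand_val (Reg 11) s) (operand_val (Reg 0) s)"
    then obtain i where i: "i \<le> floorlog 2 n" "reg s 11 = 2 ^ i" "reg s 10 = b * i" by blast
    have p: "2 ^ i \<le> n" using c I i by (simp add: graph_def)
    then have i': "Suc i \<le> floorlog 2 n" by (intro floorlog_ge_SucI) auto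
    then have "b * Suc i \<le> cap" unfolding cap_def by (rule mult_le_mono2)
    then have bi: "b * i + b < 2 ^ w" by (intro cap_fits) simp
    have pi: "2 ^ i * 2 < (2 :: nat) ^ w" using p m_ge by (intro fits) simp
    have "floorlog 2 n - i = Suc (floorlog 2 n - Suc i)" using i' by simp
    then show "run w (Arith 11 Mul (Reg 11) (Imm 2) ;; Arith 10 Add (Reg 10) (Imm b)) s
        (\<lambda>t s'. ?I s' \<and> 1 + t + ?f s' \<le> ?f s)"
      using I i bi pi i' b_pos
      by (auto simp: graph_def clean_def div_add1_eq[of "b * i" b] intro!: exI[of _ "Suc i"])
  next
    fix t s' assume I: "?I s'" and c: "\<not> comparison_val Le (operand_val (Reg 11) s') (operand_val (Reg 0) s')"
      and t: "t + ?f s' \<le> 1 + ?f ?s"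
    then obtain i where i: "i \<le> floorlog 2 n" "reg s' 11 = 2 ^ i" "reg s' 10 = b * i" by blast
    then have "floorlog 2 n \<le> i" using c I by (intro floorlog_leI) (auto simp: graph_def)
    then have "i = floorlog 2 n" using i by simp
    then show "t \<le> 3 * floorlog 2 n + 1 \<and> graph s' \<and> clean s' \<and> reg s' 2 = r \<and> reg s' 10 = cap"
      using I i t by (simp add: cap_def)
  qed
  then show ?thesis unfolding label_cap_def
    by (auto elim!: run_mono intro!: fits)
qed

text \<open>\<open>fs\<close> gives the head of the list of each vertex and \<open>nx\<close> the
  link from each half-edge to the next one.\<close>

definition links :: "nat \<Rightarrow> (nat \<Rightarrow> nat) \<Rightarrow> (nat \<Rightarrow> nat) \<Rightarrow> bool" where
  "links N nx fs \<longleftrightarrow> (\<forall>u<n. last_half_edge N u (fs u)) \<and>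
     (\<forall>i<N. last_half_edge i (origin i) (nx i))"

lemma last_half_edge_Suc:
  "last_half_edge N u p \<Longrightarrow> last_half_edge (Suc N) u (if u = origin N then Suc N else p)"
  by (auto simp: last_half_edge_def less_Suc_eq)

lemma links_Suc:
  assumes "links N nx fs" "N < 2 * m"
  shows "links (Suc N) (nx(N := fs (origin N))) (fs(origin N := Suc N))"
  unfolding links_def
proof (intro conjI allI impI)
  fix u assume "u < n"
  then have "last_half_edge N u (fs u)" using assms(1) unfolding links_def by blast
  from last_half_edge_Suc[OF this] show "last_half_edge (Suc N) u ((fs(origin N := Suc N)) u)"
    by (simp split: if_splits)
next
  fix i assume "i < Suc N"
  then show "last_half_edge i (origin i) ((nx(N := fs (origin N))) i)"
    using assms(1) origin_less[OF assms(2)] unfolding links_def by (cases "i = N") simp_all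
qed

lemma run_insert_half_edge:
  assumes l: "links (reg s 8) (arr s 5) (arr s 6)" "reg s 8 < 2 * m" "reg s r = origin (reg s 8)"
    and r: "r \<noteq> 8" "r \<noteq> 9"
  shows "run w (insert_half_edge r) s (\<lambda>t s'. t = 4 \<and> reg s' 8 = Suc (reg s 8) \<and>
    links (Suc (reg s 8)) (arr s' 5) (arr s' 6) \<and> (\<forall>q. q \<noteq> 8 \<longrightarrow> q \<noteq> 9 \<longrightarrow> reg s' q = reg s q) \<and>
    (\<forall>a. a \<noteq> 5 \<longrightarrow> a \<noteq> 6 \<longrightarrow> arr s' a = arr s a))"
proof -
  note o = origin_less[OF l(2)]
  have "arr s 6 (origin (reg s 8)) \<le> reg s 8"
    using l(1) o unfolding links_def last_half_edge_def by blast
  then have small: "arr s 6 (origin (reg s 8)) < 2 ^ w" "reg s 8 < 2 ^ w" "Suc (reg s 8) < 2 ^ w"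
      "origin (reg s 8) < 2 ^ w"
    using l(2) o m_ge by (auto intro!: fits)
  show ?thesis
    using small r links_Suc[OF l(1,2)] unfolding insert_half_edge_def
    by (simp add: l(3) cong: run_weak_cong)
qed

definition adjacency_lists :: "state \<Rightarrow> bool" where
  "adjacency_lists s \<longleftrightarrow> graph s \<and> arr s 11 = (\<lambda>_. 0) \<and> links (2 * m) (arr s 5) (arr s 6)"

lemma run_build:
  assumes "graph s" "clean s" "reg s 2 = r" "reg s 10 = cap"
  shows "run w build s (\<lambda>t s'. t \<le> 17 * m + 2 \<and> adjacency_lists s' \<and> reg s' 2 = r \<and> reg s' 10 = cap \<and>
    oriented (arr s' 10) (arr s' 9) \<and> pointers (arr s' 7))"
proof -
  let ?I = "\<lambda>i s. graph s \<and> reg s 2 = r \<and> reg s 10 = cap \<and> arr s 7 = (\<lambda>_. 0) \<and> arr s 11 = (\<lambda>_. 0) \<and>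
    (\<forall>j<i. arr s 10 j = fst (es ! j)) \<and>
    (\<forall>u<n. arr s 9 u = card {j. j < i \<and> fst (es ! j) = u}) \<and> links (2 * i) (arr s 5) (arr s 6)"
  show ?thesis unfolding build_def
  proof (rule run_For[where I = ?I and N = m and B = 15])
    show "m < 2 ^ w" by (rule fits) simp
    show "?I 0 (s\<lparr>reg := (reg s)(5 := 0)\<rparr>)"
      using assms by (auto simp: graph_def clean_def links_def last_half_edge_def)
  next
    fix i s assume I: "?I i s" and i: "i < m" "reg s 5 = i"
    let ?a = "fst (es ! i)" and ?b = "snd (es ! i)"
    have small: "Suc (card {j. j < i \<and> fst (es ! j) = ?a}) < 2 ^ w" "i < 2 ^ w" "2 * i < 2 ^ w"
        "?a < 2 ^ w"
      using card_less_le[of i "\<lambda>j. fst (es ! j) = ?a"] i ends_less[OF i(1)] m_ge by (auto intro!: fits)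
    have eqs: "reg s 5 = i" "arr s 0 i = ?a" "arr s (Suc 0) i = ?b"
        "arr s 9 ?a = card {j. j < i \<and> fst (es ! j) = ?a}"
      and lk: "links (2 * i) (arr s 5) (arr s 6)"
      using I i ends_less[OF i(1)] by (auto simp: graph_def)
    let ?s = "s\<lparr>arr := (arr s)(10 := (arr s 10)(i := ?a), 9 := (arr s 9)(?a := Suc (arr s 9 ?a))),
      reg := (reg s)(6 := ?a, 7 := ?b, 8 := 2 * i)\<rparr>"
    have "run w insert_edge ?s
      (\<lambda>t s'. t = 8 \<and> links (2 * Suc i) (arr s' 5) (arr s' 6) \<and>
        (\<forall>q. q \<noteq> 8 \<longrightarrow> q \<noteq> 9 \<longrightarrow> reg s' q = reg ?s q) \<and> (\<forall>a. a \<noteq> 5 \<longrightarrow> a \<noteq> 6 \<longrightarrow> arr s' a = arr ?s a))"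
      unfolding insert_edge_def run_Seq
    proof (rule run_mono[OF run_insert_half_edge], goal_cases)
      case (6 t1 s1)
      have s1: "reg s1 8 = Suc (2 * i)" "links (Suc (2 * i)) (arr s1 5) (arr s1 6)" "reg s1 7 = ?b"
        using 6 by simp_all
      show ?case
        by (rule run_mono[OF run_insert_half_edge]) (use 6 s1 i in simp_all)
    qed (use lk i in simp_all)
    then have "run w insert_edge ?s (\<lambda>t s'. t = 8 \<and> reg s' 5 = i \<and> ?I (Suc i) (s'\<lparr>reg := (reg s')(5 := Suc i)\<rparr>))"
    proof (rule run_mono, elim conjE, goal_cases)
      case (1 t s')
      have "reg s' 0 = n" "reg s' 1 = m" "reg s' 2 = r" "reg s' 10 = cap" "reg s' 5 = i"
          "arr s' 0 = arr s 0" "arr s' 1 = arr s 1" "arr s' 7 = (\<lambda>_. 0)" "arr s' 11 = (\<lambda>_. 0)"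
          "arr s' 10 = (arr s 10)(i := ?a)" "arr s' 9 = (arr s 9)(?a := Suc (arr s 9 ?a))"
        using 1(4,5) I i by (simp_all add: graph_def)
      then show ?case using 1(2,3) I
        by (simp add: graph_def card_less_Suc_if All_less_Suc)
    qed
    then show "run w (Load 6 0 (Reg 5) ;; Load 7 1 (Reg 5) ;; Store 10 (Reg 5) (Reg 6) ;;
     Load 8 9 (Reg 6) ;; Arith 8 Add (Reg 8) (Imm 1) ;; Store 9 (Reg 6) (Reg 8) ;;
     Arith 8 Mul (Imm 2) (Reg 5) ;; insert_edge) s
     (\<lambda>t s'. t \<le> 15 \<and> reg s' 5 = i \<and> ?I (Suc i) (s'\<lparr>reg := (reg s')(5 := Suc i)\<rparr>))"
      using small by (simp add: eqs cong: run_weak_cong) (auto elim!: run_mono)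
  next
    fix t s' assume I: "?I m s'" and t: "t \<le> (15 + 2) * m + 2"
    have tail: "arr s' 10 j = fst (es ! j)" if "j < m" for j using I that by blast
    then have "{j. j < m \<and> arr s' 10 j = u} = {j. j < m \<and> fst (es ! j) = u}" for u by (metis (lifting))
    then have "oriented (arr s' 10) (arr s' 9)" using I tail unfolding oriented_def ends_def by simp
    then show "t \<le> 17 * m + 2 \<and> adjacency_lists s' \<and> reg s' 2 = r \<and> reg s' 10 = cap \<and>
      oriented (arr s' 10) (arr s' 9) \<and> pointers (arr s' 7)"
      using I t by (auto simp: adjacency_lists_def pointers_def)
  qed (use assms in \<open>auto simp: graph_def\<close>)
qed

definition too_small :: "nat \<Rightarrow> bool" where
  "too_small k \<longleftrightarrow> real k < (1 + 1 / real b) * dens"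

text \<open>By Bernoulli's inequality, \<open>(1 + 1 / b) ^ b\<close> is at least 2.\<close>

lemma n_less_cap_power: "real n < (1 + 1 / real b) ^ cap"
proof -
  have "-1 \<le> 1 / real b" by (rule order_trans[of _ 0]) auto
  then have "2 \<le> (1 + 1 / real b) ^ b"
    using Bernoulli_inequality[of "1 / real b" b] b_pos by simp
  then have "2 ^ floorlog 2 n \<le> ((1 + 1 / real b) ^ b) ^ floorlog 2 n" by (intro power_mono) auto
  moreover have "real n < 2 ^ floorlog 2 n" using floorlog_n(3) by (metis of_nat_less_iff of_nat_numeral of_nat_power)
  ultimately show ?thesis unfolding cap_def power_mult by linarith
qed

text \<open>
  Register 16 holds the vertex \<open>x\<close> that carries the excess being routed, register 15 the vertex
  \<open>v\<close> from which routing started; all vertices below \<open>v\<close> other than \<open>x\<close> are already within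
  their bound.
\<close>

definition walk_inv :: "nat \<Rightarrow> nat \<Rightarrow> state \<Rightarrow> bool" where
  "walk_inv k h s \<longleftrightarrow> adjacency_lists s \<and> reg s 10 = cap \<and> reg s 12 = k \<and> reg s 13 = h \<and>
     oriented (arr s 10) (arr s 9) \<and> pointers (arr s 7) \<and>
     (reg s 14 = 1 \<and> labelled k (arr s 10) (arr s 7) (arr s 9) (arr s 8) \<and>
        (\<forall>u<n. arr s 8 u < cap) \<and> reg s 15 \<le> n \<and> (reg s 15 < n \<longrightarrow> reg s 16 < n) \<and> (reg s 15 = n \<longrightarrow> reg s 16 = n) \<and>
        (\<forall>u<reg s 15. arr s 9 u \<le> k + (if u = reg s 16 then 1 else 0)) \<or>
      reg s 14 = 0 \<and> reg s 15 = n \<and> too_small k)"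

text \<open>A scan or relabelling lowers the potential and so frees 60 units: at most 30 for moving
  \<open>x\<close> away from \<open>v\<close>, the rest for its running time. Returning to
  \<open>v\<close> is paid for by the second term and advancing \<open>v\<close> by the
  third.\<close>

definition walk_measure :: "state \<Rightarrow> nat" where
  "walk_measure s = 60 * potential cap (arr s 7) (arr s 8) +
     (if reg s 16 = reg s 15 then 0 else 30) + 30 * (n - reg s 15)"

lemma run_walk_step:
  assumes I: "walk_inv k h s" and v: "reg s 15 < n"
  shows "run w walk_step s (\<lambda>t s'. walk_inv k h s' \<and> 1 + t + walk_measure s' \<le> walk_measure s)"
proof -
  define x where "x = reg s 16"
  define v where "v = reg s 15"
  define C where "C = arr s 7"
  define H where "H = arr s 8"
  define G where "G = arr s 9"
  define D where "D = arr s 10"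
  define fs where "fs = arr s 6"
  define nx where "nx = arr s 5"
  note defs = x_def[symmetric] v_def[symmetric] C_def[symmetric] H_def[symmetric] G_def[symmetric]
    D_def[symmetric] fs_def[symmetric] nx_def[symmetric]
  have vn: "v < n" using v by (simp add: v_def)
  have adj: "reg s 0 = n" "reg s 1 = m" "\<forall>j<m. arr s 0 j = fst (es ! j)" "\<forall>j<m. arr s 1 j = snd (es ! j)"
      "arr s 11 = (\<lambda>_. 0)" and lk: "links (2 * m) nx fs"
    using I by (auto simp: walk_inv_def adjacency_lists_def graph_def defs)
  have r: "reg s 10 = cap" "reg s 12 = k" "reg s 13 = h" "reg s 14 = 1"
    and o: "oriented D G" and p: "pointers C" and l: "labelled k D C G H"
    and Hc: "\<And>u. u < n \<Longrightarrow> H u < cap" and x: "x < n"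
    and less: "\<And>u. u < v \<Longrightarrow> G u \<le> k + (if u = x then 1 else 0)"
    using I vn by (auto simp: walk_inv_def defs)
  have xs: "x < 2 ^ w" "v < 2 ^ w" "Suc v < 2 ^ w" "n < 2 ^ w" using x vn m_ge by (auto intro!: fits)
  have Gs: "G u < 2 ^ w" "Suc (G u) < 2 ^ w" if "u < n" for u
    using oriented_le[OF o that] by (auto intro!: fits)
  have Hs: "H u < 2 ^ w" "Suc (H u) < 2 ^ w" if "u < n" for u
    using Hc[OF that] by (auto intro!: cap_fits)
  show ?thesis
  proof (cases "k < G x")
    case False
    have less': "\<And>u. u < v \<Longrightarrow> G u \<le> k" using less False by (metis add.right_neutral leI)
    show ?thesis
      using False adj(3,4) lk o p l Hc x less' xs vn unfolding walk_step_def
      by (cases "x = v")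
        (simp_all add: walk_inv_def walk_measure_def adjacency_lists_def graph_def defs
          adj(1,2,5)[unfolded One_nat_def] r[unfolded One_nat_def] less_Suc_eq cong: run_weak_cong)
  next
    case True
    show ?thesis
    proof (cases "C x")
      case 0
      have lh: "last_half_edge (2 * m) x (fs x)" using lk x unfolding links_def by blast
      then have fx: "fs x < 2 ^ w" unfolding last_half_edge_def by (auto intro!: fits)
      note rl = labelled_relabel[OF p x 0 lh l True]
      have pot: "potential cap (C(x := fs x)) (H(x := Suc (H x))) < potential cap C H"
        using rl(3) Hc x by blast
      have Hx: "Suc (H x) < cap" if "Suc (H x) \<noteq> cap" using Hc[OF x] that by linarith
      \<comment> \<open>The orientation and the new labels are valid, so the label at the cap is a
        certificate of failure.\<close>
      have fail: "too_small k" if "Suc (H x) = cap"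
        unfolding too_small_def
        by (rule label_bound[OF o rl(1) x _ _ n_less_cap_power]) (use that in auto)
      show ?thesis
        using True 0 adj(3,4) lk o rl(1,2) Hc x less xs vn fx Hs[OF x] pot fail Hx
        unfolding walk_step_def relabel_step_def
        by (cases "x = v"; cases "Suc (H x) = cap")
          (simp_all add: walk_inv_def walk_measure_def adjacency_lists_def graph_def defs
            adj(1,2,5)[unfolded One_nat_def] r[unfolded One_nat_def] cong: run_weak_cong)
    next
      case (Suc i)
      have i: "i < 2 * m" "origin i = x"
        using p x Suc unfolding pointers_def by force+
      have lh: "last_half_edge i x (nx i)" using lk i unfolding links_def by blast
      note nh = next_half_edge[OF p x Suc lh]
      have sm: "i < 2 ^ w" "i div 2 < 2 ^ w" "nx i < 2 ^ w"
        using i lh unfolding last_half_edge_def by (auto intro!: fits)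
      have j: "i div 2 < m" using i by (rule_tac half_edge_div)
      have y: "target i < n" "target i \<noteq> x" "target i < 2 ^ w"
        using target_less[OF i(1)] origin_neq_target[OF i(1)] i(2) m_ge by (auto intro!: fits)
      have sum: "fst (es ! (i div 2)) + snd (es ! (i div 2)) - x = target i"
        "fst (es ! (i div 2)) + snd (es ! (i div 2)) < 2 ^ w"
        using i(2) ends_less[OF j] m_ge by (auto simp: origin_def target_def intro!: fits split: if_splits)
      show ?thesis
      proof (cases "D (i div 2) = x \<and> H (target i) < H x")
        case False
        have la: "labelled k D (C(x := nx i)) G H"
          by (rule labelled_advance[OF p x Suc lh l]) (use False in auto)
        show ?thesis
          using True False Suc adj(3,4) lk o la Hc x less xs vn nh(3) nh(4)[of cap H] sm j y sum
          unfolding walk_step_def scan_step_def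
          by (simp add: walk_inv_def walk_measure_def adjacency_lists_def graph_def defs
            adj(1,2,5)[unfolded One_nat_def] r[unfolded One_nat_def] cong: run_weak_cong)
      next
        case push: True
        note la = labelled_push[OF p x Suc lh l conjunct1[OF push] conjunct2[OF push] True]
          and op = oriented_push[OF i o conjunct1[OF push]]
        let ?G = "G(x := G x - 1, target i := Suc (G (target i)))"
        let ?s = "s\<lparr>arr := (arr s)(7 := C(x := nx i)),
          reg := (reg s)(6 := G x, 7 := i div 2, 8 := target i, 9 := H (target i), 11 := H x)\<rparr>"
        let ?t = "?s\<lparr>arr := (arr ?s)(10 := D(i div 2 := target i), 9 := ?G),
          reg := (reg ?s)(6 := Suc (G (target i)), 16 := target i)\<rparr>"
        have run: "run w push_step ?s (\<lambda>t s'. t = 7 \<and> s' = ?t)"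
          using Gs[OF x] Gs[OF y(1)] y xs sm unfolding push_step_def
          by (simp add: defs cong: run_weak_cong)
        have inv: "walk_inv k h ?t"
        proof -
          \<comment> \<open>Below \<open>v\<close> only \<open>x\<close> may exceed
            \<open>k\<close>, and only by one; the push hands this surplus on to the target.\<close>
          have "?G u \<le> k + (if u = target i then 1 else 0)" if "u < v" for u
            using less[OF that] less[of "target i"] that y(2) by (auto split: if_splits)
          then show ?thesis
            using adj(3,4) lk op la Hc vn nh(3) y(1)
            by (simp add: walk_inv_def adjacency_lists_def graph_def defs
              adj(1,2,5)[unfolded One_nat_def] r[unfolded One_nat_def])
        qed
        have "walk_measure ?t + 30 \<le> walk_measure s"
          using nh(4)[of cap H] by (auto simp: walk_measure_def defs)
        then have "run w push_step ?s (\<lambda>t s'. t = 7 \<and> walk_inv k h s' \<and>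
            walk_measure s' + 30 \<le> walk_measure s)"
          by (intro run_mono[OF run]) (use inv in blast)
        then show ?thesis
          using True push Suc adj(3,4) xs sm j y sum
          unfolding walk_step_def scan_step_def
          by (simp add: defs adj(1,2,5)[unfolded One_nat_def] r[unfolded One_nat_def] cong: run_weak_cong)
            (auto elim!: run_mono)
      qed
    qed
  qed
qed

end

section \<open>Testing one out-degree bound, and the search for the first success\<close>

definition walk :: com where
  "walk = While Lt (Reg 15) (Reg 0) walk_step"

definition clear_labels :: com where
  "clear_labels = For 5 (Reg 0) (Store 8 (Reg 5) (Imm 0))"

definition attempt :: com where
  "attempt = clear_labels ;; Move 14 (Imm 1) ;; Move 15 (Imm 0) ;; Move 16 (Imm 0) ;; walk ;;
     If Eq (Reg 14) (Imm 0) (Arith 12 Add (Reg 12) (Reg 13)) Skip"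

definition search :: "nat \<Rightarrow> com" where
  "search b = Move 12 (Reg 2) ;; Arith 13 Div (Reg 2) (Imm b) ;; Arith 13 Add (Reg 13) (Imm 1) ;;
     Move 14 (Imm 0) ;; While Eq (Reg 14) (Imm 0) attempt"

context ram_input
begin

lemma run_walk:
  assumes "walk_inv k h s"
  shows "run w walk s (\<lambda>t s'. t \<le> 1 + walk_measure s \<and> walk_inv k h s' \<and> \<not> reg s' 15 < n)"
  unfolding walk_def
proof (rule run_While[where I = "walk_inv k h" and f = walk_measure])
  fix s assume I: "walk_inv k h s" and c: "comparison_val Lt (operand_val (Reg 15) s) (operand_val (Reg 0) s)"
  then have "reg s 15 < n" by (simp add: walk_inv_def adjacency_lists_def graph_def)
  from run_walk_step[OF I this]
  show "run w walk_step s (\<lambda>t s'. walk_inv k h s' \<and> 1 + t + walk_measure s' \<le> walk_measure s)" .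
next
  fix t s' assume "walk_inv k h s'" "\<not> comparison_val Lt (operand_val (Reg 15) s') (operand_val (Reg 0) s')"
    "t + walk_measure s' \<le> 1 + walk_measure s"
  then show "t \<le> 1 + walk_measure s \<and> walk_inv k h s' \<and> \<not> reg s' 15 < n"
    by (auto simp: walk_inv_def adjacency_lists_def graph_def)
qed (rule assms)

lemma run_clear_labels:
  assumes "graph s"
  shows "run w clear_labels s (\<lambda>t s'. t \<le> 3 * n + 2 \<and> (\<forall>u<n. arr s' 8 u = 0) \<and>
    (\<forall>a. a \<noteq> 8 \<longrightarrow> arr s' a = arr s a) \<and> (\<forall>q. q \<noteq> 5 \<longrightarrow> reg s' q = reg s q))"
  unfolding clear_labels_def
proof (rule run_For[where N = n and B = 1 and I = "\<lambda>i s'. (\<forall>u<i. arr s' 8 u = 0) \<and>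
    (\<forall>a. a \<noteq> 8 \<longrightarrow> arr s' a = arr s a) \<and> (\<forall>q. q \<noteq> 5 \<longrightarrow> reg s' q = reg s q)"], goal_cases)
  case 1 then show ?case using m_ge by (intro fits) simp
next
  case 2 then show ?case using assms by (simp add: graph_def)
next
  case (4 i s')
  then have "i < 2 ^ w" "0 < (2 :: nat) ^ w" using m_ge by (auto intro!: fits)
  then show ?case using 4 by (simp add: All_less_Suc)
qed simp_all

text \<open>The tested value is the initial one or exceeds a failed one by exactly \<open>h\<close>;
  this keeps the first success close to the optimum.\<close>

definition search_inv :: "nat \<Rightarrow> nat \<Rightarrow> state \<Rightarrow> bool" where
  "search_inv r h s \<longleftrightarrow> adjacency_lists s \<and> reg s 10 = cap \<and> reg s 13 = h \<and>
     oriented (arr s 10) (arr s 9) \<and> pointers (arr s 7) \<and>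
     (reg s 12 = r \<or> (\<exists>k. reg s 12 = k + h \<and> too_small k)) \<and>
     (reg s 14 = 0 \<or> reg s 14 = 1 \<and> (\<forall>u<n. arr s 9 u \<le> reg s 12))"

lemma too_small_le: "too_small k \<Longrightarrow> real k \<le> 2 * dens"
proof -
  assume "too_small k"
  moreover have "(1 + 1 / real b) * dens \<le> 2 * dens"
    using b_pos one_le_dens by (intro mult_right_mono) auto
  ultimately show ?thesis unfolding too_small_def by linarith
qed

lemma run_attempt:
  assumes I: "search_inv r h s" and ok: "reg s 14 = 0" and h: "h \<le> m + 1"
  shows "run w attempt s (\<lambda>t s'. t \<le> 240 * ((cap + 1) * m) \<and> search_inv r h s' \<and>
    (reg s' 14 = 1 \<and> reg s' 12 = reg s 12 \<or> reg s' 14 = 0 \<and> too_small (reg s 12) \<and> reg s' 12 = reg s 12 + h))"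
proof -
  define k where "k = reg s 12"
  have gr: "graph s" using I by (simp add: search_inv_def adjacency_lists_def)
  have cl: "run w clear_labels s (\<lambda>t s'. t \<le> 3 * n + 2 \<and> walk_inv k h (s'\<lparr>reg := (reg s')(14 := 1, 15 := 0, 16 := 0)\<rparr>))"
  proof (rule run_mono[OF run_clear_labels[OF gr]], elim conjE, intro conjI)
    fix t and s' :: state assume H: "\<forall>u<n. arr s' 8 u = 0" and a: "\<forall>a. a \<noteq> 8 \<longrightarrow> arr s' a = arr s a"
      and q: "\<forall>q. q \<noteq> 5 \<longrightarrow> reg s' q = reg s q"
    have "labelled k (arr s 10) (arr s 7) (arr s 9) (arr s' 8)" using H by (intro labelled_zero) blast
    then show "walk_inv k h (s'\<lparr>reg := (reg s')(14 := 1, 15 := 0, 16 := 0)\<rparr>)"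
      using I H a q n_ge cap_pos
      by (simp add: walk_inv_def search_inv_def adjacency_lists_def graph_def k_def)
  qed
  have after: "run w (walk ;; If Eq (Reg 14) (Imm 0) (Arith 12 Add (Reg 12) (Reg 13)) Skip) s1
      (\<lambda>t s'. t + 3 * n + 5 \<le> 240 * ((cap + 1) * m) \<and> search_inv r h s' \<and>
      (reg s' 14 = 1 \<and> reg s' 12 = k \<or> reg s' 14 = 0 \<and> too_small k \<and> reg s' 12 = k + h))"
    if s1: "walk_inv k h s1" for s1
    unfolding run_Seq
  proof (rule run_mono[OF run_walk[OF s1]], elim conjE)
    fix t s2 assume t: "t \<le> 1 + walk_measure s1" and w2: "walk_inv k h s2" and v: "\<not> reg s2 15 < n"
    have "potential cap (arr s1 7) (arr s1 8) \<le> (cap + 1) * (3 * m)"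
      using s1 by (intro potential_le) (simp add: walk_inv_def)
    moreover have "walk_measure s1 \<le> 60 * potential cap (arr s1 7) (arr s1 8) + 30 + 30 * n"
      by (auto simp: walk_measure_def)
    ultimately have "walk_measure s1 \<le> 180 * ((cap + 1) * m) + 30 + 30 * n" by simp
    moreover have "m \<le> (cap + 1) * m" by simp
    \<comment> \<open>The potential accounts for a factor 180; the other 60 absorb the terms linear
      in \<open>n\<close> and the constants, as \<open>n \<le> m\<close> and
      \<open>m \<ge> 2\<close>.\<close>
    ultimately have t': "t + 3 * n + 8 \<le> 240 * ((cap + 1) * m)" using t m_ge two_le_m by linarith
    have a2: "adjacency_lists s2" "reg s2 10 = cap" "reg s2 12 = k" "reg s2 13 = h"
        "oriented (arr s2 10) (arr s2 9)" "pointers (arr s2 7)" using w2 by (auto simp: walk_inv_def)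
    have kk: "k = r \<or> (\<exists>k'. k = k' + h \<and> too_small k')" using I by (simp add: search_inv_def k_def)
    show "run w (If Eq (Reg 14) (Imm 0) (Arith 12 Add (Reg 12) (Reg 13)) Skip) s2
      (\<lambda>t2 s'. t + t2 + 3 * n + 5 \<le> 240 * ((cap + 1) * m) \<and> search_inv r h s' \<and>
      (reg s' 14 = 1 \<and> reg s' 12 = k \<or> reg s' 14 = 0 \<and> too_small k \<and> reg s' 12 = k + h))"
    proof (cases "reg s2 14 = 0")
      case True
      then have ts: "too_small k" using w2 by (auto simp: walk_inv_def)
      then have "real k \<le> 2 * real m" using too_small_le[OF ts] dens_le_m by linarith
      then have "k + h < 2 ^ w" using h by (intro fits) linarith
      then show ?thesis using True a2 ts t'
        by (auto simp: search_inv_def adjacency_lists_def graph_def)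
    next
      case False
      then have "reg s2 14 = 1" "\<forall>u<n. arr s2 9 u \<le> k" using w2 v by (auto simp: walk_inv_def)
      then show ?thesis using a2 t' kk by (simp add: search_inv_def)
    qed
  qed
  have one: "1 < (2 :: nat) ^ w" by (rule fits) simp
  show ?thesis unfolding attempt_def
    apply (subst run_Seq)
  proof (rule run_mono[OF cl], elim conjE)
    fix t and s1 :: state assume t: "t \<le> 3 * n + 2" and w1: "walk_inv k h (s1\<lparr>reg := (reg s1)(14 := 1, 15 := 0, 16 := 0)\<rparr>)"
    have "run w (walk ;; If Eq (Reg 14) (Imm 0) (Arith 12 Add (Reg 12) (Reg 13)) Skip)
      (s1\<lparr>reg := (reg s1)(14 := 1, 15 := 0, 16 := 0)\<rparr>)
      (\<lambda>t' s'. t + (1 + (1 + (1 + t'))) \<le> 240 * ((cap + 1) * m) \<and> search_inv r h s' \<and>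
      (reg s' 14 = 1 \<and> reg s' 12 = reg s 12 \<or> reg s' 14 = 0 \<and> too_small (reg s 12) \<and> reg s' 12 = reg s 12 + h))"
      by (rule run_mono[OF after[OF w1]]) (use t in \<open>auto simp: k_def\<close>)
    then show "run w (Move 14 (Imm 1) ;; Move 15 (Imm 0) ;; Move 16 (Imm 0) ;; walk ;;
       If Eq (Reg 14) (Imm 0) (Arith 12 Add (Reg 12) (Reg 13)) Skip) s1
      (\<lambda>t' s'. t + t' \<le> 240 * ((cap + 1) * m) \<and> search_inv r h s' \<and>
      (reg s' 14 = 1 \<and> reg s' 12 = reg s 12 \<or> reg s' 14 = 0 \<and> too_small (reg s 12) \<and> reg s' 12 = reg s 12 + h))"
      unfolding run_Seq[of w "Move a b" for a b] run_Move using one by simp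
  qed
qed

text \<open>A failed value is at most \<open>2 * dens\<close>, hence at most \<open>16 * r\<close>.
  Starting from \<open>r\<close> in steps of \<open>h > r / b\<close>, the number of tests is
  therefore linear in \<open>b\<close> and independent of the graph.\<close>

lemma run_search:
  assumes s: "adjacency_lists s" "reg s 10 = cap" "oriented (arr s 10) (arr s 9)" "pointers (arr s 7)"
    and r: "reg s 2 = r" "1 \<le> r" "real r \<le> dens" "dens \<le> 8 * real r"
  shows "run w (search b) s (\<lambda>t s'. t \<le> 241 * (15 * b + 3) * ((cap + 1) * m) \<and> adjacency_lists s' \<and>
    oriented (arr s' 10) (arr s' 9) \<and> (\<forall>u<n. arr s' 9 u \<le> reg s' 12) \<and>
    real (reg s' 12) < (1 + 2 / real b) * dens + 1)"
proof -
  define h where "h = r div b + 1"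
  define M where "M = (cap + 1) * m"
  let ?T = "241 * M"
  \<comment> \<open>The quotient bounds the failures still possible; the last summand pays for the
    successful test.\<close>
  let ?f = "\<lambda>s. ?T * ((16 * r + h - reg s 12) div h + (if reg s 14 = 0 then 1 else 0))"
  let ?s = "s\<lparr>reg := (reg s)(12 := r, 13 := h, 14 := 0)\<rparr>"
  have rm: "r \<le> m" using r dens_le_m by linarith
  have hpos: "h \<noteq> 0" by (simp add: h_def)
  have hm: "h \<le> m + 1" using rm div_le_dividend[of r b] unfolding h_def by linarith
  have M: "2 \<le> M" unfolding M_def using two_le_m cap_pos by (metis add_leD2 mult_le_mono nat_mult_1 le_add2)
  have rb: "r < b * h" using b_pos unfolding h_def
    by (metis add.commute dividend_less_div_times less_le_trans mult.commute mult_Suc_right order_refl plus_1_eq_Suc zero_less_one)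
  have "run w (While Eq (Reg 14) (Imm 0) attempt) ?s
    (\<lambda>t s'. t + 4 \<le> 241 * (15 * b + 3) * M \<and> adjacency_lists s' \<and>
      oriented (arr s' 10) (arr s' 9) \<and> (\<forall>u<n. arr s' 9 u \<le> reg s' 12) \<and>
      real (reg s' 12) < (1 + 2 / real b) * dens + 1)"
  proof (rule run_While[where I = "search_inv r h" and f = ?f])
    show "search_inv r h ?s" using s by (simp add: search_inv_def adjacency_lists_def graph_def)
  next
    fix s assume I: "search_inv r h s" and "comparison_val Eq (operand_val (Reg 14) s) (operand_val (Imm 0) s)"
    then have ok: "reg s 14 = 0" by simp
    show "run w attempt s (\<lambda>t s'. search_inv r h s' \<and> 1 + t + ?f s' \<le> ?f s)"
    proof (rule run_mono[OF run_attempt[OF I ok hm, folded M_def]], elim conjE, intro conjI)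
      fix t s' assume t: "t \<le> 240 * M"
        and c: "reg s' 14 = 1 \<and> reg s' 12 = reg s 12 \<or> reg s' 14 = 0 \<and> too_small (reg s 12) \<and> reg s' 12 = reg s 12 + h"
        and I': "search_inv r h s'"
      have t': "1 + t \<le> ?T" using t M by linarith
      define a where "a = (16 * r + h - reg s 12) div h + 1"
      define a' where "a' = (16 * r + h - reg s' 12) div h + (if reg s' 14 = 0 then 1 else 0)"
      from c have "Suc a' \<le> a"
      proof
        assume "reg s' 14 = 1 \<and> reg s' 12 = reg s 12"
        then show "Suc a' \<le> a" unfolding a_def a'_def by simp
      next
        assume 0: "reg s' 14 = 0 \<and> too_small (reg s 12) \<and> reg s' 12 = reg s 12 + h"
        then have "real (reg s 12) \<le> 16 * real r" using too_small_le[of "reg s 12"] r by linarith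
        then have "reg s 12 \<le> 16 * r" by linarith
        then have "16 * r + h - reg s 12 = (16 * r - reg s 12) + h" "16 * r + h - reg s' 12 = 16 * r - reg s 12"
          using 0 by simp_all
        then have "a = Suc ((16 * r - reg s 12) div h) + 1" "a' = (16 * r - reg s 12) div h + 1"
          unfolding a_def a'_def using 0 hpos by (simp_all only: div_add_self2[OF hpos]) simp_all
        then show "Suc a' \<le> a" by simp
      qed
      then have "?T * Suc a' \<le> ?T * a" by (rule mult_le_mono2)
      then have "1 + t + ?T * a' \<le> ?T * a" using t' unfolding mult_Suc_right by linarith
      then show "1 + t + ?f s' \<le> ?f s" unfolding a_def a'_def using ok by simp
    qed
  next
    fix t s' assume I: "search_inv r h s'" and c: "\<not> comparison_val Eq (operand_val (Reg 14) s') (operand_val (Imm 0) s')"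
      and t: "t + ?f s' \<le> 1 + ?f ?s"
    have "15 * r + h \<le> 15 * (b * h) + h" using rb by simp
    then have "15 * r + h \<le> (15 * b + 1) * h" by (simp only: add_mult_distrib mult.assoc mult_1)
    then have "(15 * r + h) div h \<le> 15 * b + 1"
      using div_le_mono[of "15 * r + h" "(15 * b + 1) * h" h] hpos by simp
    then have "?T * ((15 * r + h) div h + 1) \<le> ?T * (15 * b + 2)" by (intro mult_le_mono2) simp
    moreover have "16 * r + h - r = 15 * r + h" by simp
    then have "?f ?s = ?T * ((15 * r + h) div h + 1)" by simp
    moreover have "t \<le> 1 + ?f ?s" using t by linarith
    ultimately have "t \<le> 1 + ?T * (15 * b + 2)" by linarith
    moreover have "241 * (15 * b + 3) * M = ?T * (15 * b + 2) + ?T" by (simp only: algebra_simps)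
    ultimately have t': "t + 4 \<le> 241 * (15 * b + 3) * M" using M by linarith
    have "real (reg s' 12) < (1 + 2 / real b) * dens + 1"
    proof (cases "reg s' 12 = r")
      case True
      have "dens \<le> (1 + 2 / real b) * dens" using one_le_dens by (simp add: algebra_simps)
      then show ?thesis using True r by linarith
    next
      case False
      then obtain k where k: "reg s' 12 = k + h" "too_small k" using I by (auto simp: search_inv_def)
      \<comment> \<open>The failed \<open>k\<close> is below \<open>(1 + 1 / b) * dens\<close>, and
        the increment adds at most \<open>dens / b + 1\<close>.\<close>
      have "real (r div b) \<le> real r / real b" by (rule of_nat_div_le_of_nat)
      also have "\<dots> \<le> dens / real b" using r by (simp add: divide_right_mono)
      finally show ?thesis using k unfolding h_def too_small_def by (simp add: algebra_simps)
    qed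
    then show "t + 4 \<le> 241 * (15 * b + 3) * M \<and> adjacency_lists s' \<and>
      oriented (arr s' 10) (arr s' 9) \<and> (\<forall>u<n. arr s' 9 u \<le> reg s' 12) \<and>
      real (reg s' 12) < (1 + 2 / real b) * dens + 1"
      using I c t' by (auto simp: search_inv_def)
  qed
  moreover have "r < 2 ^ w" "h < 2 ^ w" "r div b < 2 ^ w" "0 < (2 :: nat) ^ w"
    using rm hm h_def by (auto intro!: fits)
  ultimately show ?thesis unfolding search_def run_Seq run_Move run_Arith M_def[symmetric]
    using r(1) by (simp add: h_def) (auto elim!: run_mono)
qed

end

section \<open>Numbering the out-edges and reading off the partition\<close>

text \<open>An edge gets as its class the number of earlier edges with the same tail. Register 0
  keeps the largest count, the maximum again being formed by truncated subtraction.\<close>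

definition number_classes :: com where
  "number_classes = Move 0 (Imm 0) ;; For 5 (Reg 1)
    (Load 6 10 (Reg 5) ;; Load 7 11 (Reg 6) ;; Store 2 (Reg 5) (Reg 7) ;;
     Arith 7 Add (Reg 7) (Imm 1) ;; Store 11 (Reg 6) (Reg 7) ;;
     Arith 7 Sub (Reg 7) (Reg 0) ;; Arith 0 Add (Reg 0) (Reg 7))"

definition pseudoforest_program :: "nat \<Rightarrow> com" where
  "pseudoforest_program b = peel ;; label_cap b ;; build ;; search b ;; number_classes"

text \<open>The last line makes \<open>K\<close> the exact maximum of the counts, so that no class
  below \<open>K\<close> is empty.\<close>

definition numbered :: "nat \<Rightarrow> (nat \<Rightarrow> nat) \<Rightarrow> (nat \<Rightarrow> nat) \<Rightarrow> (nat \<Rightarrow> nat) \<Rightarrow> nat \<Rightarrow> bool" where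
  "numbered N D cl cnt K \<longleftrightarrow>
     (\<forall>u. cnt u = card {j. j < N \<and> D j = u}) \<and>
     (\<forall>j<N. cl j < cnt (D j)) \<and> (\<forall>u. \<forall>l<cnt u. \<exists>j<N. D j = u \<and> cl j = l) \<and>
     (\<forall>i<N. \<forall>j<N. D i = D j \<longrightarrow> cl i = cl j \<longrightarrow> i = j) \<and>
     (\<forall>u. cnt u \<le> K) \<and> (K = 0 \<or> (\<exists>u. cnt u = K))"

lemma
  assumes "numbered N D cl cnt K"
  shows numbered_count: "cnt u = card {j. j < N \<and> D j = u}"
    and numbered_less: "j < N \<Longrightarrow> cl j < cnt (D j)"
    and numbered_surj: "l < cnt u \<Longrightarrow> \<exists>j<N. D j = u \<and> cl j = l"
    and numbered_inj: "i < N \<Longrightarrow> j < N \<Longrightarrow> D i = D j \<Longrightarrow> cl i = cl j \<Longrightarrow> i = j"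
    and numbered_le: "cnt u \<le> K"
    and numbered_max: "K \<noteq> 0 \<Longrightarrow> \<exists>u. cnt u = K"
  using assms unfolding numbered_def by blast+

lemma numbered_Suc:
  assumes "numbered N D cl cnt K"
  defines "u \<equiv> D N"
  shows "numbered (Suc N) D (cl(N := cnt u)) (cnt(u := Suc (cnt u))) (K + (Suc (cnt u) - K))"
proof -
  let ?cl = "cl(N := cnt u)" and ?cnt = "cnt(u := Suc (cnt u))"
  note c = numbered_count[OF assms(1)] and lt = numbered_less[OF assms(1)]
    and sur = numbered_surj[OF assms(1)] and inj = numbered_inj[OF assms(1)]
    and le = numbered_le[OF assms(1)] and K = numbered_max[OF assms(1)]
  show ?thesis unfolding numbered_def
  proof (intro conjI)
    show "\<forall>v. ?cnt v = card {j. j < Suc N \<and> D j = v}"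
      unfolding card_less_Suc_if by (simp add: c u_def)
    show "\<forall>j<Suc N. ?cl j < ?cnt (D j)"
    proof (intro allI impI)
      fix j assume j: "j < Suc N"
      show "?cl j < ?cnt (D j)"
      proof (cases "j = N")
        case False
        then have "cl j < cnt (D j)" using lt j by simp
        then show ?thesis using False by (auto intro: less_SucI)
      qed (simp add: u_def)
    qed
    show "\<forall>v. \<forall>l<?cnt v. \<exists>j<Suc N. D j = v \<and> ?cl j = l"
    proof (intro allI impI)
      fix v l assume l: "l < ?cnt v"
      show "\<exists>j<Suc N. D j = v \<and> ?cl j = l"
      proof (cases "v = u \<and> l = cnt u")
        case True then show ?thesis by (intro exI[of _ N]) (simp add: u_def)
      next
        case False
        then have "l < cnt v" using l by (auto split: if_splits)
        then obtain j where "j < N" "D j = v" "cl j = l" using sur by blast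
        then show ?thesis by (intro exI[of _ j]) simp
      qed
    qed
    show "\<forall>i<Suc N. \<forall>j<Suc N. D i = D j \<longrightarrow> ?cl i = ?cl j \<longrightarrow> i = j"
    proof (intro allI impI)
      fix i j assume ij: "i < Suc N" "j < Suc N" "D i = D j" "?cl i = ?cl j"
      have ne: "cl j' \<noteq> cnt u" if "j' < N" "D j' = u" for j' using lt[OF that(1)] that(2) by simp
      have "i = N \<or> i < N" "j = N \<or> j < N" using ij by linarith+
      then show "i = j" using ij(3,4) inj[of i j] ne[of i] ne[of j] unfolding u_def by auto
    qed
    show "\<forall>v. ?cnt v \<le> K + (Suc (cnt u) - K)" using trans_le_add1[OF le] by simp
    show "K + (Suc (cnt u) - K) = 0 \<or> (\<exists>v. ?cnt v = K + (Suc (cnt u) - K))"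
    proof (cases "Suc (cnt u) \<le> K")
      case True
      then obtain v where v: "cnt v = K" using K by (cases "K = 0") auto
      then have "v \<noteq> u" using True by auto
      then show ?thesis using v True by (intro disjI2 exI[of _ v]) simp
    qed (auto intro!: exI[of _ u])
  qed
qed

context edge_list
begin

text \<open>The listed pairs are distinct and contain no loop such as \<open>(0, 0)\<close>. The
  strict bound serves to derive the word size from \<open>log 2 n\<close>.\<close>

lemma m_less_square: "m < n * n"
proof -
  have "m = card (set es)"
    using lists unfolding lists_edges_def by (metis distinct_card distinct_map)
  also have "\<dots> < card ({0..<n} \<times> {0..<n})"
  proof (rule psubset_card_mono)
    have "set es \<subseteq> {0..<n} \<times> {0..<n}"
      using ends_less by (force simp: in_set_conv_nth)
    moreover have "(0, 0) \<notin> set es" using ends_neq by (force simp: in_set_conv_nth)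
    moreover have "(0, 0) \<in> {0..<n} \<times> {0..<n}" using n_ge by simp
    ultimately show "set es \<subset> {0..<n} \<times> {0..<n}" by blast
  qed simp
  finally show ?thesis by simp
qed

definition edge_class :: "(nat \<Rightarrow> nat) \<Rightarrow> nat \<Rightarrow> nat set set" where
  "edge_class cl l = {ends (es ! j) | j. j < m \<and> cl j = l}"

lemma ends_inj: "i < m \<Longrightarrow> j < m \<Longrightarrow> ends (es ! i) = ends (es ! j) \<Longrightarrow> i = j"
  using lists unfolding lists_edges_def by (metis length_map nth_eq_iff_index_eq nth_map)

lemma edge_iff: "e \<in> E \<longleftrightarrow> (\<exists>j<m. e = ends (es ! j))"
  using lists unfolding lists_edges_def by (metis edge_mem in_set_conv_nth length_map nth_map)

text \<open>Edges with the same tail have different numbers, so within a class every vertex has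
  out-degree at most one.\<close>

lemma edge_class_pseudoforest:
  assumes D: "\<forall>j<m. D j \<in> ends (es ! j)" and num: "numbered m D cl cnt K"
  shows "pseudoforest {0..<n} (edge_class cl l)"
proof -
  define tail where "tail e = D (THE j. j < m \<and> ends (es ! j) = e)" for e
  have t: "tail (ends (es ! j)) = D j" if "j < m" for j
    unfolding tail_def using that ends_inj by (intro arg_cong[of _ _ D] the_equality) auto
  have sub: "edge_class cl l \<subseteq> E" unfolding edge_class_def using edge_mem by blast
  interpret out_degree_one "edge_class cl l" tail
  proof
    show "tail e \<in> e" if "e \<in> edge_class cl l" for e
      using that t D unfolding edge_class_def by auto
    show "card e = 2" if "e \<in> edge_class cl l" for e
      using that sub simple unfolding simple_graph_def by blast
    show "inj_on tail (edge_class cl l)"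
    proof (rule inj_onI)
      fix e e' assume "e \<in> edge_class cl l" "e' \<in> edge_class cl l" and eq: "tail e = tail e'"
      then obtain i j where ij: "e = ends (es ! i)" "i < m" "cl i = l" "e' = ends (es ! j)" "j < m" "cl j = l"
        unfolding edge_class_def by blast
      then have "D i = D j" using eq t by simp
      then have "i = j" using numbered_inj[OF num] ij by simp
      then show "e = e'" using ij by simp
    qed
  qed
  show ?thesis
    using sub simple by (intro pseudoforest_out_degree_one) (auto simp: simple_graph_def)
qed

text \<open>A vertex with \<open>K\<close> out-edges has one in every class, so all classes are
  non-empty and hence, being disjoint, also distinct.\<close>

lemma edge_classes_partition:
  assumes D: "\<forall>j<m. D j \<in> ends (es ! j)" and num: "numbered m D cl cnt K"
  defines "\<F> \<equiv> {edge_class cl l | l. l < K}"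
  shows "pseudoforest_partition {0..<n} E \<F>" "card \<F> = K" "\<forall>j<m. cl j < K"
proof -
  show clK: "\<forall>j<m. cl j < K" using numbered_less[OF num] numbered_le[OF num] less_le_trans by blast
  have ne: "edge_class cl l \<noteq> {}" if "l < K" for l
  proof -
    obtain u where "cnt u = K" using numbered_max[OF num] \<open>l < K\<close> by auto
    then obtain j where "j < m" "cl j = l" using numbered_surj[OF num, of l u] \<open>l < K\<close> by blast
    then show ?thesis unfolding edge_class_def by blast
  qed
  have dis: "l = l'" if "e \<in> edge_class cl l" "e \<in> edge_class cl l'" for e l l'
    using that ends_inj unfolding edge_class_def by blast
  have "partition_on E \<F>"
  proof (rule partition_onI)
    show "\<Union>\<F> = E"
    proof
      show "\<Union>\<F> \<subseteq> E" unfolding \<F>_def edge_class_def using edge_mem by blast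
      show "E \<subseteq> \<Union>\<F>"
      proof
        fix e assume "e \<in> E"
        then obtain j where "j < m" "e = ends (es ! j)" using edge_iff by blast
        then have "e \<in> edge_class cl (cl j)" "cl j < K" unfolding edge_class_def using clK by auto
        then show "e \<in> \<Union>\<F>" unfolding \<F>_def by blast
      qed
    qed
    show "disjnt p q" if pq: "p \<in> \<F>" "q \<in> \<F>" "p \<noteq> q" for p q
    proof -
      from pq obtain l l' where "p = edge_class cl l" "q = edge_class cl l'" unfolding \<F>_def by blast
      then show ?thesis using pq(3) dis unfolding disjnt_def by blast
    qed
    show "{} \<notin> \<F>" using ne unfolding \<F>_def by auto
  qed
  then show "pseudoforest_partition {0..<n} E \<F>"
    using edge_class_pseudoforest[OF D num] unfolding pseudoforest_partition_def \<F>_def by blast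
  have "inj_on (edge_class cl) {..<K}"
    using ne dis by (metis (no_types, lifting) ex_in_conv inj_onI lessThan_iff)
  moreover have "\<F> = edge_class cl ` {..<K}" unfolding \<F>_def by auto
  ultimately show "card \<F> = K" by (simp add: card_image)
qed

end

context ram_input
begin

lemma run_number_classes:
  assumes s: "adjacency_lists s" "oriented (arr s 10) (arr s 9)"
  shows "run w number_classes s (\<lambda>t s'. t \<le> 9 * m + 3 \<and>
    numbered m (arr s 10) (arr s' 2) (arr s' 11) (reg s' 0))"
proof -
  define D where "D = arr s 10"
  have D: "D j < n" if "j < m" for j
    using s(2) that ends_less[OF that] unfolding oriented_def D_def ends_def by auto
  let ?I = "\<lambda>i s. reg s 1 = m \<and> arr s 10 = D \<and> numbered i D (arr s 2) (arr s 11) (reg s 0) \<and> reg s 0 \<le> i"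
  have "run w (For 5 (Reg 1)
    (Load 6 10 (Reg 5) ;; Load 7 11 (Reg 6) ;; Store 2 (Reg 5) (Reg 7) ;;
     Arith 7 Add (Reg 7) (Imm 1) ;; Store 11 (Reg 6) (Reg 7) ;;
     Arith 7 Sub (Reg 7) (Reg 0) ;; Arith 0 Add (Reg 0) (Reg 7))) (s\<lparr>reg := (reg s)(0 := 0)\<rparr>)
     (\<lambda>t s'. 1 + t \<le> 9 * m + 3 \<and> numbered m D (arr s' 2) (arr s' 11) (reg s' 0))"
  proof (rule run_For[where I = ?I and N = m and B = 7])
    show "m < 2 ^ w" by (rule fits) simp
    show "?I 0 ((s\<lparr>reg := (reg s)(0 := 0)\<rparr>)\<lparr>reg := (reg (s\<lparr>reg := (reg s)(0 := 0)\<rparr>))(5 := 0)\<rparr>)"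
      using s(1) by (simp add: adjacency_lists_def graph_def numbered_def D_def)
  next
    fix i and s :: state assume I: "?I i s" and i: "i < m" "reg s 5 = i"
    have num: "numbered i D (arr s 2) (arr s 11) (reg s 0)" and K: "reg s 0 \<le> i" using I by auto
    have "arr s 11 (D i) = card {j. j < i \<and> D j = D i}" by (rule numbered_count[OF num])
    then have c: "arr s 11 (D i) \<le> i" by (simp add: card_less_le)
    have small: "i < 2 ^ w" "D i < 2 ^ w" "arr s 11 (D i) < 2 ^ w" "Suc (arr s 11 (D i)) < 2 ^ w"
        "Suc (arr s 11 (D i)) - reg s 0 < 2 ^ w" "reg s 0 + (Suc (arr s 11 (D i)) - reg s 0) < 2 ^ w"
      using i(1) D[OF i(1)] m_ge c K by (auto intro!: fits)
    show "run w (Load 6 10 (Reg 5) ;; Load 7 11 (Reg 6) ;; Store 2 (Reg 5) (Reg 7) ;;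
     Arith 7 Add (Reg 7) (Imm 1) ;; Store 11 (Reg 6) (Reg 7) ;;
     Arith 7 Sub (Reg 7) (Reg 0) ;; Arith 0 Add (Reg 0) (Reg 7)) s
     (\<lambda>t s'. t \<le> 7 \<and> reg s' 5 = i \<and> ?I (Suc i) (s'\<lparr>reg := (reg s')(5 := Suc i)\<rparr>))"
      using I i small c K numbered_Suc[OF num] by (simp cong: run_weak_cong)
  qed auto
  then show ?thesis unfolding number_classes_def D_def[symmetric] run_Seq run_Move
    by (simp add: D_def)
qed

definition time_factor :: nat where
  "time_factor = 500 + 241 * (15 * b + 3) * (b + 1)"

lemma run_pseudoforest_program:
  "run w (pseudoforest_program b) (input_state n es) (\<lambda>t s'. t \<le> time_factor * (m * floorlog 2 n) \<and>
    (\<exists>D cnt. (\<forall>j<m. D j \<in> ends (es ! j)) \<and> numbered m D (arr s' 2) cnt (reg s' 0)) \<and>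
    real (reg s' 0) < (1 + 2 / real b) * dens + 1)"
proof -
  let ?s = "input_state n es" and ?l = "floorlog 2 n"
  have g: "graph ?s" "clean ?s" "reg ?s 2 = 0" "arr ?s 3 = (\<lambda>_. 0)" "arr ?s 4 = (\<lambda>_. 0)"
    by (auto simp: input_state_def graph_def clean_def)
  show ?thesis unfolding pseudoforest_program_def run_Seq
  proof (rule run_mono[OF run_peel[OF g]], elim conjE)
    fix t1 s1 assume t1: "t1 \<le> 40 * m * ?l + 2" and s1: "graph s1" "clean s1"
      and r: "1 \<le> reg s1 2" "real (reg s1 2) \<le> dens" "dens \<le> 8 * real (reg s1 2)"
    show "run w (label_cap b) s1 (\<lambda>t2 s2. run w build s2 (\<lambda>t3 s3. run w (search b) s3
        (\<lambda>t4 s4. run w number_classes s4 (\<lambda>t5 s'. t1 + (t2 + (t3 + (t4 + t5))) \<le> time_factor * (m * ?l) \<and>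
        (\<exists>D cnt. (\<forall>j<m. D j \<in> ends (es ! j)) \<and> numbered m D (arr s' 2) cnt (reg s' 0)) \<and>
        real (reg s' 0) < (1 + 2 / real b) * dens + 1))))"
    proof (rule run_mono[OF run_label_cap[OF s1 refl]], elim conjE)
      fix t2 s2 assume t2: "t2 \<le> 3 * ?l + 3" and s2: "graph s2" "clean s2" "reg s2 2 = reg s1 2" "reg s2 10 = cap"
      show "run w build s2 (\<lambda>t3 s3. run w (search b) s3
        (\<lambda>t4 s4. run w number_classes s4 (\<lambda>t5 s'. t1 + (t2 + (t3 + (t4 + t5))) \<le> time_factor * (m * ?l) \<and>
        (\<exists>D cnt. (\<forall>j<m. D j \<in> ends (es ! j)) \<and> numbered m D (arr s' 2) cnt (reg s' 0)) \<and>
        real (reg s' 0) < (1 + 2 / real b) * dens + 1)))"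
      proof (rule run_mono[OF run_build[OF s2]], elim conjE)
        fix t3 s3 assume t3: "t3 \<le> 17 * m + 2" and s3: "adjacency_lists s3" "reg s3 2 = reg s1 2"
            "reg s3 10 = cap" "oriented (arr s3 10) (arr s3 9)" "pointers (arr s3 7)"
        show "run w (search b) s3
          (\<lambda>t4 s4. run w number_classes s4 (\<lambda>t5 s'. t1 + (t2 + (t3 + (t4 + t5))) \<le> time_factor * (m * ?l) \<and>
          (\<exists>D cnt. (\<forall>j<m. D j \<in> ends (es ! j)) \<and> numbered m D (arr s' 2) cnt (reg s' 0)) \<and>
          real (reg s' 0) < (1 + 2 / real b) * dens + 1))"
        proof (rule run_mono[OF run_search[OF s3(1,3,4,5,2) r]], elim conjE)
          fix t4 s4 assume t4: "t4 \<le> 241 * (15 * b + 3) * ((cap + 1) * m)" and s4: "adjacency_lists s4"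
            and o: "oriented (arr s4 10) (arr s4 9)" and G: "\<forall>u<n. arr s4 9 u \<le> reg s4 12"
            and k: "real (reg s4 12) < (1 + 2 / real b) * dens + 1"
          show "run w number_classes s4 (\<lambda>t5 s'. t1 + (t2 + (t3 + (t4 + t5))) \<le> time_factor * (m * ?l) \<and>
            (\<exists>D cnt. (\<forall>j<m. D j \<in> ends (es ! j)) \<and> numbered m D (arr s' 2) cnt (reg s' 0)) \<and>
            real (reg s' 0) < (1 + 2 / real b) * dens + 1)"
          proof (rule run_mono[OF run_number_classes[OF s4 o]], elim conjE, intro conjI)
            fix t5 s' assume t5: "t5 \<le> 9 * m + 3"
              and num: "numbered m (arr s4 10) (arr s' 2) (arr s' 11) (reg s' 0)"
            have D: "\<forall>j<m. arr s4 10 j \<in> ends (es ! j)" using o by (simp add: oriented_def)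
            then show "\<exists>D cnt. (\<forall>j<m. D j \<in> ends (es ! j)) \<and> numbered m D (arr s' 2) cnt (reg s' 0)"
              using num by blast
            \<comment> \<open>The number of classes is the out-degree of some vertex, which the
              successful test bounds by the accepted \<open>k\<close>.\<close>
            have "reg s' 0 \<le> reg s4 12"
            proof (cases "reg s' 0 = 0")
              case False
              then obtain u where u: "arr s' 11 u = reg s' 0" using numbered_max[OF num] by blast
              then obtain j where j: "j < m" "arr s4 10 j = u"
                using numbered_surj[OF num, of 0 u] False by auto
              then have un: "u < n" using D ends_less[OF j(1)] by (auto simp: ends_def)
              have "reg s' 0 = arr s4 9 u"
                using o un numbered_count[OF num, of u] u by (simp add: oriented_def)
              then show ?thesis using G un by simp
            qed simp
            then show "real (reg s' 0) < (1 + 2 / real b) * dens + 1" using k by linarith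
            have l: "1 \<le> ?l" using floorlog_n by simp
            have "cap + 1 \<le> (b + 1) * ?l" using l by (simp add: cap_def)
            then have "(cap + 1) * m \<le> (b + 1) * (m * ?l)" by (metis mult.assoc mult.commute mult_le_mono1)
            then have "241 * (15 * b + 3) * ((cap + 1) * m) \<le> 241 * (15 * b + 3) * ((b + 1) * (m * ?l))"
              by (rule mult_le_mono2)
            then have t4': "t4 \<le> 241 * (15 * b + 3) * (b + 1) * (m * ?l)" using t4 by (simp only: mult.assoc)
            have "m \<le> m * ?l" "?l \<le> m * ?l" using l two_le_m by simp_all
            moreover have "1 \<le> m * ?l" using l two_le_m by simp
            moreover have "40 * m * ?l = 40 * (m * ?l)" by simp
            ultimately have "t1 + t2 + t3 + t5 \<le> 500 * (m * ?l)" using t1 t2 t3 t5 by linarith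
            then show "t1 + (t2 + (t3 + (t4 + t5))) \<le> time_factor * (m * ?l)"
              using t4' unfolding time_factor_def add_mult_distrib by linarith
          qed
        qed
      qed
    qed
  qed
qed

end

section \<open>Choice of the precision, the word length and the time constant\<close>

theorem theorem21:
  fixes \<epsilon> :: real
  assumes "\<epsilon> > 0"
  shows "\<exists>(P :: com) (A :: real) (c :: real). c \<ge> 2 \<and>
    (\<forall>(n :: nat) (m :: nat) (E :: nat set set) (es :: (nat \<times> nat) list) (w :: nat).
       n \<ge> 2 \<longrightarrow> m \<ge> n \<longrightarrow> simple_graph {0..<n} E \<longrightarrow> card E = m \<longrightarrow>
       lists_edges es E \<longrightarrow> real w \<ge> c * log 2 (real n) \<longrightarrow>
       (\<exists>t s. exec w P (input_state n es) t s \<and>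
              real t \<le> A * real m * log 2 (real n) \<and>
              (\<exists>\<F>. outputs_family s es \<F> \<and>
                   pseudoforest_partition {0..<n} E \<F> \<and>
                   int (card \<F>) \<le> \<lceil>(1 + \<epsilon>) * max_density {0..<n} E\<rceil>)))"
proof -
  \<comment> \<open>The search loses a factor \<open>1 + 2 / b\<close>, which this choice keeps
    within \<open>1 + \<epsilon>\<close>.\<close>
  obtain b :: nat where b: "2 / \<epsilon> < real b" using reals_Archimedean2 by blast
  then have b0: "0 < real b" using assms by (meson divide_pos_pos less_trans zero_less_numeral)
  then have b1: "1 \<le> b" by simp
  have be: "2 / real b \<le> \<epsilon>" using b b0 assms by (simp add: field_simps)
  let ?F = "500 + 241 * (15 * b + 3) * (b + 1) :: nat"
  show ?thesis
  proof (rule exI[of _ "pseudoforest_program b"], rule exI[of _ "2 * real ?F"],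
      rule exI[of _ "real (b + 10)"], intro conjI allI impI)
    show "2 \<le> real (b + 10)" by simp
    fix n m :: nat and E :: "nat set set" and es :: "(nat \<times> nat) list" and w :: nat
    assume n: "2 \<le> n" and m: "n \<le> m" and E: "simple_graph {0..<n} E" "card E = m" "lists_edges es E"
      and w: "real (b + 10) * log 2 (real n) \<le> real w"
    have lm: "length es = m" using E unfolding lists_edges_def by (metis distinct_card length_map)
    interpret edge_list n E es
      by unfold_locales (use n m E lm in auto)
    \<comment> \<open>This is where the factor \<open>b + 10\<close> in the word length comes from:
      \<open>n ^ (b + 8)\<close> exceeds \<open>b + 8\<close>, and \<open>n * n\<close> is at least
      \<open>m + 1\<close>.\<close>
    have "(b + 8) * (m + 1) < n ^ (b + 10)"
    proof -
      have "b + 8 < 2 ^ (b + 8)" by (rule less_exp)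
      also have "\<dots> \<le> n ^ (b + 8)" using n by (intro power_mono) auto
      finally have "b + 8 < n ^ (b + 8)" .
      moreover have "m + 1 \<le> n * n" using m_less_square lm by simp
      ultimately have "(b + 8) * (m + 1) < n ^ (b + 8) * (n * n)" using n by (intro mult_less_le_imp_less) auto
      also have "\<dots> = n ^ (b + 10)" by (simp add: power_add power2_eq_square numeral_eq_Suc)
      finally show ?thesis .
    qed
    also have "n ^ (b + 10) \<le> 2 ^ w"
    proof -
      have "real (n ^ (b + 10)) = 2 powr (real (b + 10) * log 2 (real n))"
      proof -
        have "2 powr (real (b + 10) * log 2 (real n)) = (2 powr log 2 (real n)) powr real (b + 10)"
          unfolding powr_powr by (simp only: mult.commute)
        also have "\<dots> = real n powr real (b + 10)" using n by simp
        also have "\<dots> = real (n ^ (b + 10))" using n by (subst powr_realpow) simp_all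
        finally show ?thesis by simp
      qed
      also have "\<dots> \<le> 2 powr real w" using w by simp
      also have "\<dots> = real (2 ^ w)" by (simp add: powr_realpow)
      finally show ?thesis by (simp only: of_nat_le_iff)
    qed
    finally have word: "(b + 8) * (m + 1) < 2 ^ w" .
    interpret ram_input n E es w b
      by unfold_locales (use b1 word lm in auto)
    obtain t s D cnt where ex: "exec w (pseudoforest_program b) (input_state n es) t s"
      and t: "t \<le> ?F * (m * floorlog 2 n)" and D: "\<forall>j<length es. D j \<in> ends (es ! j)"
      and num: "numbered (length es) D (arr s 2) cnt (reg s 0)"
      and k: "real (reg s 0) < (1 + 2 / real b) * max_density {0..<n} E + 1"
      using run_pseudoforest_program unfolding run_def time_factor_def lm by blast
    note part = edge_classes_partition[OF D num]
    let ?\<F> = "{edge_class (arr s 2) l | l. l < reg s 0}"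
    have "real t \<le> 2 * real ?F * real m * log 2 (real n)"
    proof -
      have "1 \<le> log 2 (real n)" using n by simp
      moreover have "real (floorlog 2 n) \<le> log 2 (real n) + 1"
      proof -
        have "real (nat \<lfloor>log 2 (real n)\<rfloor>) = of_int \<lfloor>log 2 (real n)\<rfloor>"
          using \<open>1 \<le> log 2 (real n)\<close> by (intro of_nat_nat) simp
        moreover have "floorlog 2 n = nat \<lfloor>log 2 (real n)\<rfloor> + 1" using n by (simp add: floorlog_def)
        ultimately show ?thesis using of_int_floor_le[of "log 2 (real n)"] by simp
      qed
      \<comment> \<open>The digit count exceeds the logarithm by at most 1, and
        \<open>log 2 n \<ge> 1\<close>; hence the factor 2 in the time constant.\<close>
      ultimately have l: "real (floorlog 2 n) \<le> 2 * log 2 (real n)" by linarith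
      have "real t \<le> real (?F * (m * floorlog 2 n))" using t by (simp only: of_nat_le_iff)
      also have "\<dots> = real ?F * real m * real (floorlog 2 n)" by (simp only: of_nat_mult mult.assoc)
      also have "\<dots> \<le> real ?F * real m * (2 * log 2 (real n))" using l by (intro mult_left_mono) auto
      finally show ?thesis by (simp only: mult_ac)
    qed
    moreover have "outputs_family s es ?\<F>"
      using part(2,3) unfolding outputs_family_def edge_class_def by simp
    moreover have "int (card ?\<F>) \<le> \<lceil>(1 + \<epsilon>) * max_density {0..<n} E\<rceil>"
    proof -
      have "(1 + 2 / real b) * max_density {0..<n} E \<le> (1 + \<epsilon>) * max_density {0..<n} E"
        using be one_le_dens by (intro mult_right_mono) auto
      then have "real (reg s 0) < (1 + \<epsilon>) * max_density {0..<n} E + 1" using k by linarith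
      \<comment> \<open>An integer strictly below \<open>x + 1\<close> is at most the ceiling of
        \<open>x\<close>, which absorbs the additive 1 from rounding.\<close>
      then show ?thesis unfolding part(2) by linarith
    qed
    ultimately show "\<exists>t s. exec w (pseudoforest_program b) (input_state n es) t s \<and>
        real t \<le> 2 * real ?F * real m * log 2 (real n) \<and>
        (\<exists>\<F>. outputs_family s es \<F> \<and> pseudoforest_partition {0..<n} E \<F> \<and>
          int (card \<F>) \<le> \<lceil>(1 + \<epsilon>) * max_density {0..<n} E\<rceil>)"
      using ex part(1) by blast
  qed
qed

end
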